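(* Let $d \ge 2$. Let $\phi$ be an inner function on the unit disc $\mathbb{D}$ with Clark measure $\sigma_\alpha$ for some unimodular constant $\alpha \in \mathbb{T}$, and let $\tau_\alpha$ be the Clark measure, corresponding to the same $\alpha$, of the inner function $\Phi(z_1,\dots,z_d) := \phi(z_1 z_2 \cdots z_d)$ on $\mathbb{D}^d$. Then, for all $f \in C(\mathbb{T}^d)$, $$\int_{\mathbb{T}^d} f(\xi)\, d\tau_\alpha(\xi) = \int_{\mathbb{T}} \int_{\mathbb{T}} \cdots \int_{\mathbb{T}} f(\zeta_1, \dots, \zeta_{d-1}, x\,\overline{\zeta_1 \cdots \zeta_{d-1}})\, d\sigma_\alpha(x)\, dm(\zeta_{d-1}) \cdots dm(\zeta_1).$$
   Context: $\mathbb{D}^d = \{z \in \mathbb{C}^d : |z_j| < 1,\ j=1,\dots,d\}$ and $\mathbb{T}^d = \{\zeta \in \mathbb{C}^d : |\zeta_j| = 1,\ j=1,\dots,d\}$; $m_d$ is normalized Lebesgue measure on $\mathbb{T}^d$ and $m = m_1$. A bounded holomorphic function $\phi : \mathbb{D}^d \to \mathbb{D}$ is inner if its non-tangential boundary values $\phi^*(\zeta)$, which exist for $m_d$-almost every $\zeta \in \mathbb{T}^d$, satisfy $|\phi^*(\zeta)| = 1$ for $m_d$-almost every $\zeta \in \mathbb{T}^d$. The Poisson kernel is $P(z,\zeta) = \prod_{j=1}^d \frac{1-|z_j|^2}{|\zeta_j - z_j|^2}$ for $z \in \mathbb{D}^d$, $\zeta \in \mathbb{T}^d$. For an inner function $\phi$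 on $\mathbb{D}^d$ and $\alpha \in \mathbb{T}$, the Clark measure of $\phi$ associated to $\alpha$ is the unique positive Borel measure $\sigma_\alpha$ on $\mathbb{T}^d$ with $$\frac{1-|\phi(z)|^2}{|\alpha - \phi(z)|^2} = \int_{\mathbb{T}^d} P(z,\zeta)\, d\sigma_\alpha(\zeta), \quad z \in \mathbb{D}^d.$$ *)

theory Defs
  imports "HOL-Analysis.Analysis"
begin

text \<open>
  Points of \<open>d\<close>-dimensional complex space are functions \<open>nat \<Rightarrow> complex\<close>, extensional on
  the index set \<open>{..<d}\<close>; the coordinates are numbered from \<open>0\<close> to \<open>d - 1\<close>. The type
  \<open>nat \<Rightarrow> complex\<close> carries the product topology, which on these sets induces the
  Euclidean topology. For \<open>d = 1\<close> plain complex numbers are used instead.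
\<close>

abbreviation circle :: "complex set"
  where "circle \<equiv> sphere 0 1"

abbreviation disc :: "complex set"
  where "disc \<equiv> ball 0 1"

definition torus :: "nat \<Rightarrow> (nat \<Rightarrow> complex) set"
  where "torus d = (\<Pi>\<^sub>E j\<in>{..<d}. circle)"

definition polydisc :: "nat \<Rightarrow> (nat \<Rightarrow> complex) set"
  where "polydisc d = (\<Pi>\<^sub>E j\<in>{..<d}. disc)"

definition circle_measure :: "complex measure"
  where "circle_measure =
    distr (uniform_measure lborel {0..<2 * pi}) (restrict_space borel circle) cis"

definition torus_measure :: "nat \<Rightarrow> (nat \<Rightarrow> complex) measure"
  where "torus_measure d = Pi\<^sub>M {..<d} (\<lambda>_. circle_measure)"

definition stolz_region :: "real \<Rightarrow> complex \<Rightarrow> complex set"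
  where "stolz_region \<kappa> \<zeta> = {z \<in> disc. norm (z - \<zeta>) \<le> \<kappa> * (1 - norm z)}"

definition nontangential_limit :: "(complex \<Rightarrow> complex) \<Rightarrow> complex \<Rightarrow> complex \<Rightarrow> bool"
  where "nontangential_limit \<phi> \<zeta> L \<longleftrightarrow>
    (\<forall>\<kappa>>1. (\<phi> \<longlongrightarrow> L) (at \<zeta> within stolz_region \<kappa> \<zeta>))"

text \<open>
  In several variables the approach regions are products of Stolz regions, with no
  relation imposed between the rates of approach in the individual coordinates.
\<close>

definition poly_nontangential_limit ::
    "nat \<Rightarrow> ((nat \<Rightarrow> complex) \<Rightarrow> complex) \<Rightarrow> (nat \<Rightarrow> complex) \<Rightarrow> complex \<Rightarrow> bool"
  where "poly_nontangential_limit d F \<zeta> L \<longleftrightarrow>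
    (\<forall>\<kappa>>1. (F \<longlongrightarrow> L) (at \<zeta> within (\<Pi>\<^sub>E j\<in>{..<d}. stolz_region \<kappa> (\<zeta> j))))"

text \<open>
  Holomorphy in several variables: continuous, and holomorphic in each variable separately.
\<close>

definition polydisc_holomorphic :: "nat \<Rightarrow> ((nat \<Rightarrow> complex) \<Rightarrow> complex) \<Rightarrow> bool"
  where "polydisc_holomorphic d F \<longleftrightarrow>
    continuous_on (polydisc d) F \<and>
    (\<forall>z\<in>polydisc d. \<forall>j<d. (\<lambda>w. F (z(j := w))) holomorphic_on disc)"

definition inner_disc :: "(complex \<Rightarrow> complex) \<Rightarrow> bool"
  where "inner_disc \<phi> \<longleftrightarrow>
    \<phi> holomorphic_on disc \<and> \<phi> ` disc \<subseteq> disc \<and>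
    (AE \<zeta> in circle_measure. \<exists>L. nontangential_limit \<phi> \<zeta> L \<and> norm L = 1)"

definition inner_polydisc :: "nat \<Rightarrow> ((nat \<Rightarrow> complex) \<Rightarrow> complex) \<Rightarrow> bool"
  where "inner_polydisc d F \<longleftrightarrow>
    polydisc_holomorphic d F \<and> F ` polydisc d \<subseteq> disc \<and>
    (AE \<zeta> in torus_measure d. \<exists>L. poly_nontangential_limit d F \<zeta> L \<and> norm L = 1)"

definition poisson_disc :: "complex \<Rightarrow> complex \<Rightarrow> real"
  where "poisson_disc z \<zeta> = (1 - (norm z)\<^sup>2) / (norm (\<zeta> - z))\<^sup>2"

definition poisson_polydisc :: "nat \<Rightarrow> (nat \<Rightarrow> complex) \<Rightarrow> (nat \<Rightarrow> complex) \<Rightarrow> real"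
  where "poisson_polydisc d z \<zeta> = (\<Prod>j<d. poisson_disc (z j) (\<zeta> j))"

text \<open>
  The Poisson integrals are taken in \<open>[0, \<infinity>]\<close>, so that the defining identity
  includes their finiteness; at \<open>z = 0\<close> it shows that a Clark measure is finite.
\<close>

definition clark_measure_disc ::
    "(complex \<Rightarrow> complex) \<Rightarrow> complex \<Rightarrow> complex measure \<Rightarrow> bool"
  where "clark_measure_disc \<phi> \<alpha> \<sigma> \<longleftrightarrow>
    sets \<sigma> = sets (restrict_space borel circle) \<and>
    (\<forall>z\<in>disc. (\<integral>\<^sup>+\<zeta>. ennreal (poisson_disc z \<zeta>) \<partial>\<sigma>) =
      ennreal ((1 - (norm (\<phi> z))\<^sup>2) / (norm (\<alpha> - \<phi> z))\<^sup>2))"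

definition clark_measure_polydisc ::
    "nat \<Rightarrow> ((nat \<Rightarrow> complex) \<Rightarrow> complex) \<Rightarrow> complex \<Rightarrow> (nat \<Rightarrow> complex) measure \<Rightarrow> bool"
  where "clark_measure_polydisc d F \<alpha> \<tau> \<longleftrightarrow>
    sets \<tau> = sets (restrict_space borel (torus d)) \<and>
    (\<forall>z\<in>polydisc d. (\<integral>\<^sup>+\<zeta>. ennreal (poisson_polydisc d z \<zeta>) \<partial>\<tau>) =
      ennreal ((1 - (norm (F z))\<^sup>2) / (norm (\<alpha> - F z))\<^sup>2))"

text \<open>
  The \<open>n\<close>-fold iterated integral over the circle of a function of the coordinates
  \<open>\<zeta> 0, \<dots>, \<zeta> (n - 1)\<close>, where \<open>\<zeta> (n - 1)\<close> is the innermost and \<open>\<zeta> 0\<close> the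
  outermost variable of integration. For \<open>n = 0\<close> there are no variables and the function is
  evaluated at the only point of the zero-dimensional space.
\<close>

primrec iterated_circle_integral :: "nat \<Rightarrow> ((nat \<Rightarrow> complex) \<Rightarrow> complex) \<Rightarrow> complex"
  where
    "iterated_circle_integral 0 G = G (\<lambda>_. undefined)"
  | "iterated_circle_integral (Suc n) G =
      iterated_circle_integral n (\<lambda>\<zeta>. LINT w|circle_measure. G (\<zeta>(n := w)))"

end

theory Submission
  imports Defs "HOL-Probability.Probability" "HOL-Complex_Analysis.Complex_Analysis"
begin

text \<open>
  The product map sends the torus measure to the circle measure and a product of Stolz regions
  into a Stolz region at the product point, so boundary values of \<open>\<phi>\<close> carry over.

  For the integral formula, let \<open>f\<^sub>r(\<zeta>)\<close> be the integral of \<open>f(\<eta>) P(r \<zeta>, \<eta>)\<close> over the torus, with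
  \<open>0 \<le> r < 1\<close>.  Because \<open>P(r \<zeta>, \<eta>) = P(r \<eta>, \<zeta>)\<close>, the integral of \<open>f\<^sub>r\<close> against \<open>\<tau>\<close> only involves the
  Poisson integral of \<open>\<tau>\<close> at \<open>r \<eta>\<close>, which is that of \<open>\<sigma>\<close> at \<open>r ^ d * \<Prod>\<eta>\<close>.  Rotating the kernel turns
  the integral over the last coordinate into a Poisson average of \<open>f\<close> around
  \<open>x * cnj (\<Prod>\<zeta>)\<close>.  As \<open>r \<rightarrow> 1\<close> both sides converge, the kernels being approximate identities.
\<close>

subsection \<open>The circle and the Poisson formula\<close>

lemma cis_measurable_circle [measurable]: "cis \<in> borel \<rightarrow>\<^sub>M restrict_space borel circle"
  by (intro measurable_restrict_space2 borel_measurable_continuous_onI continuous_intros)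
     (auto simp: norm_cis)

lemma sets_circle_measure [measurable_cong, simp]:
  "sets circle_measure = sets (restrict_space borel circle)"
  by (simp add: circle_measure_def)

lemma space_circle_measure [simp]: "space circle_measure = circle"
  by (simp add: circle_measure_def space_restrict_space)

lemma prob_space_circle_measure: "prob_space circle_measure"
  unfolding circle_measure_def
  by (intro prob_space.prob_space_distr prob_space_uniform_measure) simp_all

lemma nn_integral_circle_measure:
  assumes [measurable]: "g \<in> borel_measurable (restrict_space borel circle)"
  shows "(\<integral>\<^sup>+w. g w \<partial>circle_measure) =
    (\<integral>\<^sup>+t. g (cis t) * indicator {0..<2 * pi} t \<partial>lborel) / ennreal (2 * pi)"
  unfolding circle_measure_def
  by (subst nn_integral_distr) (auto simp: nn_integral_uniform_measure)

text \<open>\<open>circle_measure\<close> lives on a half-open interval so that each angle counts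
  once, while contour integrals produce the closed one; the endpoint \<open>2 * pi\<close> is a null
  set.\<close>

lemma integral_circle_measure:
  fixes F :: "complex \<Rightarrow> complex"
  assumes F: "continuous_on circle F" and I: "((\<lambda>t. F (cis t)) has_integral I) {0..2 * pi}"
  shows "(LINT w|circle_measure. F w) = I / (2 * pi)"
proof -
  have Fm [measurable]: "F \<in> borel_measurable (restrict_space borel circle)"
    using F by (rule borel_measurable_continuous_on_restrict)
  have "uniform_measure lborel {0..<2 * pi} =
      density lborel (\<lambda>t. ennreal (indicator {0..<2 * pi} t / (2 * pi)))"
    unfolding uniform_measure_def
    by (intro arg_cong[where f = "density lborel"] ext)
       (use divide_ennreal[of 1 "2 * pi"] in \<open>auto simp: indicator_def\<close>)
  then have "(LINT w|circle_measure. F w) =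
      (LINT t|lborel. (indicator {0..<2 * pi} t / (2 * pi)) *\<^sub>R F (cis t))"
    unfolding circle_measure_def
    by (simp add: integral_distr integral_density)
  also have "\<dots> = (LINT t|lborel. (indicator {0..2 * pi} t *\<^sub>R F (cis t)) / (2 * pi))"
    using AE_lborel_singleton[of "2 * pi"]
    by (intro integral_cong_AE) (auto simp: indicator_def scaleR_conv_of_real)
  also have "\<dots> = (LINT t:{0..2 * pi}|lborel. F (cis t)) / (2 * pi)"
    unfolding set_lebesgue_integral_def by simp
  also have "(LINT t:{0..2 * pi}|lborel. F (cis t)) = I"
  proof -
    have "continuous_on {0..2 * pi} (\<lambda>t. F (cis t))"
      by (intro continuous_on_compose2[OF F] continuous_intros) (auto simp: norm_cis)
    then have "set_integrable lborel {0..2 * pi} (\<lambda>t. F (cis t))"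
      by (intro borel_integrable_atLeastAtMost') 
    from set_borel_integral_eq_integral(2)[OF this] show ?thesis
      using I by (simp add: integral_unique)
  qed
  finally show ?thesis .
qed

text \<open>On the circle \<open>cnj w\<close> is the inverse of \<open>w\<close>, so the real
  kernel becomes a rational function of \<open>w\<close> containing the Cauchy factor
  \<open>1 / (w - z)\<close>. This is what makes Cauchy's formula applicable.\<close>

lemma poisson_disc_circle_eq:
  fixes w z :: complex
  assumes "norm w = 1"
  shows "of_real (1 - (norm z)\<^sup>2) * w / ((1 - cnj z * w) * (w - z)) = of_real (poisson_disc z w)"
proof (cases "w = z")
  \<comment> \<open>With division by zero equal to 0, both sides vanish here.\<close>
  case True then show ?thesis by (simp add: poisson_disc_def)
next
  case False
  have ww: "w * cnj w = 1" using assms by (simp add: complex_norm_square[symmetric])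
  have "(1 - cnj z * w) * (w - z) = w * (cnj (w - z) * (w - z))"
    using ww by (simp add: algebra_simps)
  also have "\<dots> = w * of_real ((norm (w - z))\<^sup>2)"
    by (metis complex_norm_square mult.commute)
  finally show ?thesis using assms by (auto simp: poisson_disc_def)
qed

lemma poisson_disc_continuous:
  assumes "z \<in> disc" shows "continuous_on circle (poisson_disc z)"
  unfolding poisson_disc_def using assms by (intro continuous_intros) auto

text \<open>
  The mean value form of Cauchy's formula at \<open>z\<close> for
  \<open>u \<mapsto> f u * (1 - \<bar>z\<bar>\<^sup>2) / (1 - cnj z * u)\<close>, whose value at \<open>z\<close> is \<open>f z\<close>.
\<close>

theorem poisson_formula:
  assumes fc: "continuous_on (cball 0 1) f" and fh: "f holomorphic_on disc" and z: "z \<in> disc"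
  shows "(LINT w|circle_measure. of_real (poisson_disc z w) * f w) = f z"
proof -
  define g where "g u = f u * (1 - (norm z)\<^sup>2) / (1 - cnj z * u)" for u
  \<comment> \<open>The second pole of the kernel, at \<open>1 / cnj z\<close> when \<open>z\<close>
    is nonzero, lies outside the closed disc.\<close>
  have nz: "1 - cnj z * u \<noteq> 0" if "norm u \<le> 1" for u
  proof
    assume "1 - cnj z * u = 0"
    then have "norm (cnj z * u) = 1" by (metis eq_iff_diff_eq_0 norm_one)
    moreover have "norm (cnj z * u) < 1"
      using that z mult_left_le[of "norm u" "norm z"] by (simp add: norm_mult)
    ultimately show False by simp
  qed
  have "((\<lambda>u. g u / (u - z)) has_contour_integral 2 * of_real pi * \<i> * g z) (circlepath 0 1)"
    by (rule Cauchy_integral_circlepath)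
       (use z nz in \<open>auto simp: g_def intro!: continuous_intros holomorphic_intros fc fh\<close>)
  then have "((\<lambda>t. g (cis t) / (cis t - z) * \<i> * cis t) has_integral 2 * of_real pi * \<i> * g z) {0..2 * pi}"
    unfolding circlepath_def using has_contour_integral_part_circlepath_iff[of 0 "2 * pi"] by simp
  \<comment> \<open>The parametrisation contributes \<open>\<i> * cis t\<close>. The factor
    \<open>cis t\<close> belongs to the kernel, and multiplying by \<open>- \<i>\<close> removes the
    rest.\<close>
  then have "((\<lambda>t. (- \<i>) * (g (cis t) / (cis t - z) * \<i> * cis t)) has_integral (- \<i>) * (2 * of_real pi * \<i> * g z)) {0..2 * pi}"
    by (rule has_integral_mult_right)
  moreover have "(- \<i>) * (g (cis t) / (cis t - z) * \<i> * cis t) = of_real (poisson_disc z (cis t)) * f (cis t)" for t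
    unfolding poisson_disc_circle_eq[OF norm_cis, symmetric] g_def
    by (simp add: divide_inverse mult_ac)
  moreover have "g z = f z"
    using nz[of z] z complex_norm_square[of z] by (simp add: g_def mult.commute)
  moreover have "(- \<i>) * (2 * of_real pi * \<i> * f z) = 2 * pi * f z"
    by simp
  ultimately have "((\<lambda>t. of_real (poisson_disc z (cis t)) * f (cis t)) has_integral 2 * pi * f z) {0..2 * pi}"
    by (simp only:)
  moreover have "continuous_on circle (\<lambda>w. of_real (poisson_disc z w) * f w)"
    using poisson_disc_continuous[OF z] fc
    by (intro continuous_intros) (auto elim: continuous_on_subset)
  ultimately show ?thesis using integral_circle_measure[of "\<lambda>w. of_real (poisson_disc z w) * f w"] by simp
qed

section \<open>Rotation invariance of the circle measure\<close>

lemma nn_integral_periodic_shift: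
  fixes h :: "real \<Rightarrow> ennreal"
  assumes [measurable]: "h \<in> borel_measurable borel" and per: "\<And>s. h (s + p) = h s"
    and t: "0 \<le> t" "t \<le> p"
  shows "(\<integral>\<^sup>+s. h (s + t) * indicator {0..<p} s \<partial>lborel) = (\<integral>\<^sup>+s. h s * indicator {0..<p} s \<partial>lborel)"
proof -
  have per': "h (p + s) = h s" for s
    using per[of s] by (simp add: add.commute)
  have "(\<integral>\<^sup>+s. h s * indicator {0..<p} s \<partial>lborel) =
      (\<integral>\<^sup>+s. h s * indicator {0..<t} s \<partial>lborel) + (\<integral>\<^sup>+s. h s * indicator {t..<p} s \<partial>lborel)"
    using t by (subst nn_integral_add[symmetric]) (auto intro!: nn_integral_cong simp: indicator_def)
  \<comment> \<open>Periodicity moves the piece over \<open>[0, t)\<close> to the far end of the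
    period. This leaves the single window \<open>[t, p + t)\<close>, which a translation by
    \<open>t\<close> carries back.\<close>
  also have "(\<integral>\<^sup>+s. h s * indicator {0..<t} s \<partial>lborel) =
      (\<integral>\<^sup>+s. h s * indicator {p..<p + t} s \<partial>lborel)"
    by (subst (2) nn_integral_real_affine[where c = 1 and t = p])
       (auto intro!: nn_integral_cong simp: per' indicator_def)
  also have "\<dots> + (\<integral>\<^sup>+s. h s * indicator {t..<p} s \<partial>lborel) =
      (\<integral>\<^sup>+s. h s * indicator {t..<p + t} s \<partial>lborel)"
    using t by (subst nn_integral_add[symmetric]) (auto intro!: nn_integral_cong simp: indicator_def)
  also have "\<dots> = (\<integral>\<^sup>+s. h (s + t) * indicator {0..<p} s \<partial>lborel)"
    by (subst nn_integral_real_affine[where c = 1 and t = t])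
       (auto intro!: nn_integral_cong simp: indicator_def add.commute)
  finally show ?thesis by simp
qed

lemma mult_measurable_circle:
  assumes "norm c = 1"
  shows "(\<lambda>w. c * w) \<in> restrict_space borel circle \<rightarrow>\<^sub>M restrict_space borel circle"
  using assms
  by (intro measurable_restrict_space2 borel_measurable_continuous_on_restrict continuous_intros)
     (auto simp: norm_mult space_restrict_space)

lemma nn_integral_circle_rotate:
  assumes [measurable]: "g \<in> borel_measurable (restrict_space borel circle)" and c: "norm c = 1"
  shows "(\<integral>\<^sup>+w. g (c * w) \<partial>circle_measure) = (\<integral>\<^sup>+w. g w \<partial>circle_measure)"
proof -
  note [measurable] = mult_measurable_circle[OF c]
  obtain t where t: "0 \<le> t" "t < 2 * pi" "c = cis t"
    using Arg2pi[of c] c that[of "Arg2pi c"] by (auto simp: cis_conv_exp is_Arg_def)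
  have gc: "(\<lambda>w. g (c * w)) \<in> borel_measurable (restrict_space borel circle)"
    by measurable
  have h: "(\<lambda>s. g (cis s)) \<in> borel_measurable borel"
    by measurable
  have per: "g (cis (s + 2 * pi)) = g (cis s)" for s
    by (simp only: cis_mult[symmetric] cis_2pi mult_1_right)
  have "(\<integral>\<^sup>+w. g (c * w) \<partial>circle_measure) =
    (\<integral>\<^sup>+s. g (cis (s + t)) * indicator {0..<2 * pi} s \<partial>lborel) / ennreal (2 * pi)"
    by (subst nn_integral_circle_measure)
       (simp_all only: cis_mult[symmetric] gc, simp only: t(3)[symmetric] mult.commute)
  also have "\<dots> = (\<integral>\<^sup>+s. g (cis s) * indicator {0..<2 * pi} s \<partial>lborel) / ennreal (2 * pi)"
    by (rule arg_cong[OF nn_integral_periodic_shift[OF h per t(1) less_imp_le[OF t(2)]]])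
  also have "\<dots> = (\<integral>\<^sup>+w. g w \<partial>circle_measure)"
    by (rule nn_integral_circle_measure[OF assms(1), symmetric])
  finally show ?thesis .
qed

subsection \<open>The product map on the polydisc and the torus\<close>

interpretation circle_measure: prob_space circle_measure
  by (rule prob_space_circle_measure)

interpretation circle_product: product_sigma_finite "\<lambda>_ :: nat. circle_measure"
  by standard

interpretation torus_measure: prob_space "torus_measure d" for d
  unfolding torus_measure_def by (rule prob_space_PiM) (rule prob_space_circle_measure)

lemma space_torus_measure [simp]: "space (torus_measure d) = torus d"
  by (simp add: torus_measure_def torus_def space_PiM)

lemma circle_measurable_borel:
  assumes "g \<in> M \<rightarrow>\<^sub>M circle_measure" shows "g \<in> borel_measurable M"
  using assms by (simp add: measurable_restrict_space2_iff cong: measurable_cong_sets)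

lemma coordinate_measurable_torus [measurable]:
  "j < d \<Longrightarrow> (\<lambda>\<zeta>. \<zeta> j) \<in> torus_measure d \<rightarrow>\<^sub>M circle_measure"
  unfolding torus_measure_def by measurable

lemma upd_measurable_torus [measurable]:
  "(\<lambda>(\<zeta>, w). \<zeta>(n := w)) \<in> torus_measure n \<Otimes>\<^sub>M circle_measure \<rightarrow>\<^sub>M torus_measure (Suc n)"
  using measurable_add_dim[of n "{..<n}" "\<lambda>_. circle_measure"]
  by (simp add: torus_measure_def lessThan_Suc)

lemma coordinate_prod_measurable_torus [measurable]:
  "(\<lambda>\<zeta>. \<Prod>j<d. \<zeta> j) \<in> torus_measure d \<rightarrow>\<^sub>M restrict_space borel circle"
proof (rule measurable_restrict_space2)
  show "(\<lambda>\<zeta>. \<Prod>j<d. \<zeta> j) \<in> space (torus_measure d) \<rightarrow> circle"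
    by (auto simp: torus_def PiE_def Pi_def prod_norm[symmetric])
  show "(\<lambda>\<zeta>. \<Prod>j<d. \<zeta> j) \<in> borel_measurable (torus_measure d)"
    by (intro borel_measurable_prod circle_measurable_borel coordinate_measurable_torus) auto
qed

lemma prod_fun_upd_lessThan:
  fixes \<zeta> :: "nat \<Rightarrow> complex"
  shows "(\<Prod>j<n. (\<zeta>(n := w)) j) = (\<Prod>j<n. \<zeta> j)"
  by (rule prod.cong) auto

lemma prod_upd_last:
  fixes \<zeta> :: "nat \<Rightarrow> complex"
  shows "(\<Prod>j<Suc n. (\<zeta>(n := w)) j) = (\<Prod>j<n. \<zeta> j) * w"
  using prod_fun_upd_lessThan[of \<zeta> n w] by simp

lemma torus_prod_circle: "\<zeta> \<in> torus d \<Longrightarrow> norm (\<Prod>j<d. \<zeta> j) = 1"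
  by (auto simp: torus_def PiE_def Pi_def prod_norm[symmetric])

text \<open>The product map pushes the torus measure forward to the circle measure: with the first
  \<open>n\<close> coordinates fixed, the product is a rotation of the last one, which the inner
  integral does not see.\<close>

lemma nn_integral_torus_prod:
  assumes [measurable]: "g \<in> borel_measurable (restrict_space borel circle)"
  shows "(\<integral>\<^sup>+\<zeta>. g (\<Prod>j<Suc n. \<zeta> j) \<partial>torus_measure (Suc n)) = (\<integral>\<^sup>+w. g w \<partial>circle_measure)"
proof -
  have meas: "(\<lambda>\<zeta>. g (\<Prod>j<Suc n. \<zeta> j)) \<in> borel_measurable (Pi\<^sub>M (insert n {..<n}) (\<lambda>_. circle_measure))"
    using measurable_compose[OF coordinate_prod_measurable_torus[of "Suc n"] assms]
    by (simp add: torus_measure_def lessThan_Suc[symmetric])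
  have "(\<integral>\<^sup>+\<zeta>. g (\<Prod>j<Suc n. \<zeta> j) \<partial>torus_measure (Suc n)) =
      (\<integral>\<^sup>+\<zeta>. (\<integral>\<^sup>+w. g ((\<Prod>j<n. \<zeta> j) * w) \<partial>circle_measure) \<partial>torus_measure n)"
    using circle_product.product_nn_integral_insert[OF _ _ meas]
    by (simp only: torus_measure_def lessThan_Suc[symmetric] prod_upd_last) simp
  also have "\<dots> = (\<integral>\<^sup>+\<zeta>. (\<integral>\<^sup>+w. g w \<partial>circle_measure) \<partial>torus_measure n)"
    by (intro nn_integral_cong nn_integral_circle_rotate assms) (simp add: torus_prod_circle)
  also have "\<dots> = (\<integral>\<^sup>+w. g w \<partial>circle_measure)"
    by (simp add: torus_measure.emeasure_space_1 del: space_torus_measure)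
  finally show ?thesis .
qed

lemma AE_torus_prod:
  assumes "AE w in circle_measure. P w" and d: "0 < d"
  shows "AE \<zeta> in torus_measure d. P (\<Prod>j<d. \<zeta> j)"
proof -
  obtain n where n: "d = Suc n" using d gr0_implies_Suc by blast
  \<comment> \<open>The exceptional set need not be measurable; a null superset \<open>N\<close> has
    an indicator to which the integral identity applies.\<close>
  obtain N where N: "{w \<in> space circle_measure. \<not> P w} \<subseteq> N" "N \<in> null_sets circle_measure"
    using assms(1) by (auto elim!: AE_E simp: null_sets_def)
  have Nm [measurable]: "N \<in> sets (restrict_space borel circle)"
    using N(2) by auto
  have meas: "(\<lambda>\<zeta>. indicator N (\<Prod>j<d. \<zeta> j) :: ennreal) \<in> borel_measurable (torus_measure d)"
    by measurable
  have "(\<integral>\<^sup>+\<zeta>. indicator N (\<Prod>j<d. \<zeta> j) \<partial>torus_measure d) = 0"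
    unfolding n using N(2) by (subst nn_integral_torus_prod) (auto simp: nn_integral_indicator)
  then have "AE \<zeta> in torus_measure d. indicator N (\<Prod>j<d. \<zeta> j) = (0 :: ennreal)"
    using nn_integral_0_iff_AE[OF meas] by simp
  moreover have "AE \<zeta> in torus_measure d. \<zeta> \<in> torus d"
    using AE_space[of "torus_measure d"] by simp
  ultimately show ?thesis
        by eventually_elim (use N(1) torus_prod_circle in \<open>force simp: indicator_def split: if_splits\<close>)
qed

section \<open>Products of Stolz regions and boundary values\<close>

lemma norm_prod_le_factor:
  fixes z :: "nat \<Rightarrow> complex"
  assumes "\<And>j. j < d \<Longrightarrow> norm (z j) \<le> 1" and "i < d"
  shows "norm (\<Prod>j<d. z j) \<le> norm (z i)"
proof -
  have "norm (\<Prod>j<d. z j) = norm (z i) * (\<Prod>j\<in>{..<d} - {i}. norm (z j))"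
    using assms(2) by (simp add: prod.remove[of "{..<d}" i] norm_mult prod_norm)
  also have "\<dots> \<le> norm (z i) * 1"
    using assms by (intro mult_left_mono prod_le_1) auto
  finally show ?thesis by simp
qed

lemma prod_in_disc:
  assumes "z \<in> polydisc d" and "0 < d"
  shows "(\<Prod>j<d. z j) \<in> disc"
proof -
  have 1: "j < d \<Longrightarrow> norm (z j) < 1" for j using assms(1) by (auto simp: polydisc_def PiE_def Pi_def)
  have "norm (\<Prod>j<d. z j) \<le> norm (z 0)"
    by (intro norm_prod_le_factor assms(2)) (simp add: 1 less_imp_le)
  then show ?thesis using 1[of 0] assms(2) by simp
qed

text \<open>For factors in the closed disc the difference of two products is at most the sum of the
  differences, and each gap \<open>1 - norm (z j)\<close> is at most the gap of the whole product.
  Summing \<open>d\<close> such bounds multiplies the aperture by \<open>d\<close>.\<close>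

lemma prod_in_stolz_region:
  assumes "\<And>j. j < d \<Longrightarrow> z j \<in> stolz_region \<kappa> (\<zeta> j)" and "\<zeta> \<in> torus d"
    and d: "0 < d" and \<kappa>: "0 \<le> \<kappa>"
  shows "(\<Prod>j<d. z j) \<in> stolz_region (of_nat d * \<kappa>) (\<Prod>j<d. \<zeta> j)"
proof -
  have z1: "norm (z j) < 1" and zk: "norm (z j - \<zeta> j) \<le> \<kappa> * (1 - norm (z j))" if "j < d" for j
    using assms(1)[OF that] by (auto simp: stolz_region_def)
  have z1': "norm (z j) \<le> 1" if "j < d" for j using z1[OF that] by simp
  have "norm ((\<Prod>j<d. z j) - (\<Prod>j<d. \<zeta> j)) \<le> (\<Sum>j<d. norm (z j - \<zeta> j))"
    by (rule norm_prod_diff) (use z1' assms(2) in \<open>auto simp: torus_def PiE_def Pi_def\<close>)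
  also have "\<dots> \<le> (\<Sum>j<d. \<kappa> * (1 - norm (\<Prod>j<d. z j)))"
    using norm_prod_le_factor[of d z] z1' \<kappa>
    by (intro sum_mono order_trans[OF zk] mult_left_mono diff_left_mono) auto
  finally show ?thesis
    using norm_prod_le_factor[of d z 0] z1' z1[OF d] d by (force simp add: stolz_region_def mult.assoc)
qed

lemma continuous_on_coordinate: "continuous_on S (\<lambda>z. z j)"
  for S :: "('i \<Rightarrow> 'b :: topological_space) set"
  by (rule continuous_on_subset[OF continuous_on_product_coordinates]) simp

text \<open>The product point approaches its limit in a wider Stolz region, which is harmless
  because \<open>nontangential_limit\<close> ranges over all apertures.\<close>

lemma poly_nontangential_limit_prod:
  assumes lim: "nontangential_limit \<phi> (\<Prod>j<d. \<zeta> j) L" and \<zeta>: "\<zeta> \<in> torus d" and d: "0 < d"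
  shows "poly_nontangential_limit d (\<lambda>z. \<phi> (\<Prod>j<d. z j)) \<zeta> L"
  unfolding poly_nontangential_limit_def
proof (intro allI impI)
  fix \<kappa> :: real assume \<kappa>: "1 < \<kappa>"
  let ?S = "\<Pi>\<^sub>E j\<in>{..<d}. stolz_region \<kappa> (\<zeta> j)"
  let ?p = "\<lambda>z :: nat \<Rightarrow> complex. \<Prod>j<d. z j"
  have k1: "1 < of_nat d * \<kappa>"
  proof -
    have "1 * \<kappa> \<le> of_nat d * \<kappa>" using d \<kappa> by (intro mult_right_mono) auto
    then show ?thesis using \<kappa> by linarith
  qed
  have "isCont ?p \<zeta>"
    using continuous_on_coordinate[of UNIV]
    by (intro continuous_on_interior[of UNIV] continuous_on_prod) auto
  then have "(?p \<longlongrightarrow> ?p \<zeta>) (at \<zeta> within ?S)"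
    by (rule continuous_within_tendsto_compose') (auto intro: tendsto_ident_at)
  \<comment> \<open>The filter \<open>at\<close> is punctured, so the product must avoid its limit
    point: it stays in the open disc, while \<open>?p \<zeta>\<close> has modulus 1.\<close>
  moreover have "\<forall>\<^sub>F z in at \<zeta> within ?S. ?p z \<in> stolz_region (of_nat d * \<kappa>) (?p \<zeta>) \<and> ?p z \<noteq> ?p \<zeta>"
    unfolding eventually_at_filter
  proof (intro always_eventually allI impI)
    fix z assume "z \<in> ?S"
    then have "?p z \<in> stolz_region (of_nat d * \<kappa>) (?p \<zeta>)"
      using \<kappa> by (intro prod_in_stolz_region \<zeta> d) auto
    then show "?p z \<in> stolz_region (of_nat d * \<kappa>) (?p \<zeta>) \<and> ?p z \<noteq> ?p \<zeta>"
      using torus_prod_circle[OF \<zeta>] by (auto simp: stolz_region_def)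
  qed
  ultimately have "filterlim ?p (at (?p \<zeta>) within stolz_region (of_nat d * \<kappa>) (?p \<zeta>)) (at \<zeta> within ?S)"
    by (auto simp: filterlim_at elim: eventually_mono)
  then show "((\<lambda>z. \<phi> (?p z)) \<longlongrightarrow> L) (at \<zeta> within ?S)"
    using lim k1 unfolding nontangential_limit_def by (auto intro: filterlim_compose)
qed

lemma polydisc_holomorphic_prod:
  assumes hol: "\<phi> holomorphic_on disc" and d: "0 < d"
  shows "polydisc_holomorphic d (\<lambda>z. \<phi> (\<Prod>j<d. z j))"
  unfolding polydisc_holomorphic_def
proof (intro conjI ballI allI impI)
  show "continuous_on (polydisc d) (\<lambda>z. \<phi> (\<Prod>j<d. z j))"
    by (rule continuous_on_compose2[OF holomorphic_on_imp_continuous_on[OF hol]])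
       (use prod_in_disc d in \<open>auto intro!: continuous_on_prod continuous_on_coordinate\<close>)
next
  fix z j assume z: "z \<in> polydisc d" and j: "j < d"
  have "z(j := w) \<in> polydisc d" if "w \<in> disc" for w
    using z j that by (auto simp: polydisc_def PiE_def Pi_def extensional_def)
  then have "(\<lambda>w. \<Prod>i<d. (z(j := w)) i) ` disc \<subseteq> disc"
    using prod_in_disc d by blast
  moreover have "(\<lambda>w. \<Prod>i<d. (z(j := w)) i) holomorphic_on disc"
  proof (intro holomorphic_on_prod)
    show "(\<lambda>w. (z(j := w)) i) holomorphic_on disc" for i
      by (cases "i = j") (auto intro: holomorphic_intros)
  qed
  ultimately show "(\<lambda>w. \<phi> (\<Prod>i<d. (z(j := w)) i)) holomorphic_on disc"
    using holomorphic_on_compose_gen[OF _ hol] by (simp add: o_def)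
qed

theorem inner_polydisc_prod:
  assumes "inner_disc \<phi>" and d: "0 < d"
  shows "inner_polydisc d (\<lambda>z. \<phi> (\<Prod>j<d. z j))"
  unfolding inner_polydisc_def
proof (intro conjI)
  show "polydisc_holomorphic d (\<lambda>z. \<phi> (\<Prod>j<d. z j))"
    using assms polydisc_holomorphic_prod by (auto simp: inner_disc_def)
  show "(\<lambda>z. \<phi> (\<Prod>j<d. z j)) ` polydisc d \<subseteq> disc"
    using assms prod_in_disc unfolding inner_disc_def by blast
  have "AE \<zeta> in torus_measure d. \<exists>L. nontangential_limit \<phi> (\<Prod>j<d. \<zeta> j) L \<and> norm L = 1"
    using assms by (intro AE_torus_prod) (auto simp: inner_disc_def)
  moreover have "AE \<zeta> in torus_measure d. \<zeta> \<in> torus d"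
    using AE_space[of "torus_measure d"] by simp
  ultimately show "AE \<zeta> in torus_measure d.
      \<exists>L. poly_nontangential_limit d (\<lambda>z. \<phi> (\<Prod>j<d. z j)) \<zeta> L \<and> norm L = 1"
    by eventually_elim (use poly_nontangential_limit_prod d in blast)
qed

subsection \<open>Poisson kernels as approximate identities\<close>

lemma poisson_disc_nonneg: "norm z \<le> 1 \<Longrightarrow> 0 \<le> poisson_disc z w"
  by (auto simp: poisson_disc_def power_le_one)

text \<open>A bound uniform in the boundary points, which justifies exchanging integrals while
  \<open>r\<close> is fixed.\<close>

lemma poisson_disc_le:
  assumes "norm z \<le> r" "r < 1" "norm w = 1"
  shows "poisson_disc z w \<le> 1 / (1 - r)\<^sup>2"
proof -
  have "1 - r \<le> norm (w - z)"
    using norm_triangle_ineq2[of w z] assms by simp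
  then have "(1 - r)\<^sup>2 \<le> (norm (w - z))\<^sup>2"
    using assms by (intro power_mono) auto
  then show ?thesis
    unfolding poisson_disc_def using assms by (intro frac_le) auto
qed

lemma poisson_disc_measurable [measurable (raw)]:
  assumes [measurable]: "f \<in> borel_measurable M" "g \<in> borel_measurable M"
  shows "(\<lambda>x. poisson_disc (f x) (g x)) \<in> borel_measurable M"
  unfolding poisson_disc_def by measurable

text \<open>Conjugation inverts points of the circle, so \<open>w - r * v\<close> is
  \<open>w * v\<close> times the conjugate of \<open>v - r * w\<close>, and the two denominators
  agree. This symmetry lets an integration variable pass from one slot of the kernel to the
  other.\<close>

lemma poisson_disc_swap:
  assumes "norm v = 1" "norm w = 1"
  shows "poisson_disc (of_real r * v) w = poisson_disc (of_real r * w) v"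
proof -
  have v: "cnj v * v = 1" and w: "w * cnj w = 1"
    using assms by (simp_all add: complex_norm_square[symmetric] mult.commute[of "cnj v"])
  have "w - of_real r * v = w * v * cnj (v - of_real r * w)"
  proof -
    have "w * v * cnj (v - of_real r * w) = w * (cnj v * v) - of_real r * v * (w * cnj w)"
      by (simp add: algebra_simps)
    then show ?thesis using v w by simp
  qed
  then have "norm (w - of_real r * v) = norm (v - of_real r * w)"
    using assms by (simp add: norm_mult del: complex_cnj_diff)
  then show ?thesis using assms by (simp add: poisson_disc_def norm_mult)
qed

text \<open>Rotating both arguments by \<open>cnj c\<close> preserves the kernel; the symmetry then
  puts \<open>w\<close> in the boundary slot, where the averaging results apply.\<close>

lemma poisson_disc_rotate:
  assumes c: "norm c = 1" and "norm w = 1" "norm x = 1"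
  shows "poisson_disc (of_real r * (c * w)) x = poisson_disc (of_real r * (x * cnj c)) w"
proof -
  have cc: "c * cnj c = 1" using c by (simp add: complex_norm_square[symmetric])
  have "c * (x * cnj c - of_real r * w) = x * (c * cnj c) - of_real r * (c * w)"
    by (simp add: algebra_simps)
  then have "x - of_real r * (c * w) = c * (x * cnj c - of_real r * w)"
    using cc by simp
  then have "poisson_disc (of_real r * (c * w)) x = poisson_disc (of_real r * w) (x * cnj c)"
    using assms by (simp add: poisson_disc_def norm_mult)
  then show ?thesis using poisson_disc_swap[of w "x * cnj c" r] assms by (simp add: norm_mult)
qed

lemma borel_measurable_continuous_circle:
  "continuous_on circle g \<Longrightarrow> g \<in> borel_measurable circle_measure"
  using borel_measurable_continuous_on_restrict[of circle g]
  by (subst measurable_cong_sets[OF sets_circle_measure refl])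

lemma integrable_continuous_circle:
  fixes g :: "complex \<Rightarrow> 'b :: {banach, second_countable_topology}"
  assumes "continuous_on circle g"
  shows "integrable circle_measure g"
proof -
  have "bounded (g ` circle)"
    using assms by (intro compact_imp_bounded compact_continuous_image) auto
  then obtain B where "\<forall>w\<in>circle. norm (g w) \<le> B"
    by (auto simp: bounded_iff)
  then show ?thesis
    using borel_measurable_continuous_circle[OF assms]
    by (intro circle_measure.integrable_const_bound[of _ B] AE_I2) auto
qed

lemma integral_poisson_disc:
  assumes "z \<in> disc"
  shows "(LINT w|circle_measure. poisson_disc z w) = 1"
proof -
  have "complex_of_real (LINT w|circle_measure. poisson_disc z w) =
      (LINT w|circle_measure. of_real (poisson_disc z w) * 1)"
    by simp
  also have "\<dots> = 1"
    using assms by (intro poisson_formula) auto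
  finally show ?thesis by (simp only: of_real_eq_1_iff)
qed

text \<open>On the circle the squared distance to \<open>y\<close> is the real part of the affine
  function \<open>2 - 2 * cnj y * w\<close>, so the Poisson formula evaluates this second moment by
  inserting \<open>r * y\<close>.\<close>

lemma integral_poisson_disc_dist_sq:
  assumes y: "norm y = 1" and r: "0 \<le> r" "r < 1"
  shows "(LINT w|circle_measure. poisson_disc (of_real r * y) w * (norm (w - y))\<^sup>2) = 2 - 2 * r"
proof -
  let ?z = "of_real r * y"
  have z: "?z \<in> disc" using y r by (simp add: norm_mult)
  have yy: "cnj y * y = 1" using y by (simp add: complex_norm_square[symmetric] mult.commute)
  have sq: "(norm (w - y))\<^sup>2 = Re (2 - 2 * cnj y * w)" if "norm w = 1" for w
    using that y cmod_power2[of w] cmod_power2[of y]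
    unfolding cmod_power2[of "w - y"] by (simp add: power2_eq_square algebra_simps)
  have int: "integrable circle_measure (\<lambda>w. of_real (poisson_disc ?z w) * (2 - 2 * cnj y * w))"
    using poisson_disc_continuous[OF z] by (intro integrable_continuous_circle continuous_intros)
  have "(LINT w|circle_measure. poisson_disc ?z w * (norm (w - y))\<^sup>2) =
      (LINT w|circle_measure. Re (of_real (poisson_disc ?z w) * (2 - 2 * cnj y * w)))"
    by (intro Bochner_Integration.integral_cong) (auto simp: sq)
  also have "\<dots> = Re (LINT w|circle_measure. of_real (poisson_disc ?z w) * (2 - 2 * cnj y * w))"
    using int by (rule integral_Re)
  also have "(LINT w|circle_measure. of_real (poisson_disc ?z w) * (2 - 2 * cnj y * w)) =
      2 - 2 * cnj y * ?z"
    by (rule poisson_formula[OF _ _ z]) (auto intro!: continuous_intros holomorphic_intros)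
  also have "\<dots> = of_real (2 - 2 * r)"
    using yy by (simp add: algebra_simps)
  finally show ?thesis by simp
qed

section \<open>Product kernels and their moments\<close>

lemma poisson_polydisc_dilation:
  "poisson_polydisc d (\<lambda>j\<in>{..<d}. of_real r * \<zeta> j) \<eta> = (\<Prod>j<d. poisson_disc (of_real r * \<zeta> j) (\<eta> j))"
  unfolding poisson_polydisc_def by (rule prod.cong) auto

lemma torus_coordinate: "\<zeta> \<in> torus d \<Longrightarrow> j < d \<Longrightarrow> norm (\<zeta> j) = 1"
  by (auto simp: torus_def PiE_def Pi_def)

lemma integrable_poisson_disc_mult:
  assumes "z \<in> disc" "continuous_on circle g"
  shows "integrable circle_measure (\<lambda>w. poisson_disc z w * g w)"
  using assms by (intro integrable_continuous_circle continuous_intros poisson_disc_continuous)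

lemma integral_poisson_polydisc:
  assumes \<zeta>: "\<zeta> \<in> torus d" and r: "0 \<le> r" "r < 1"
  shows "integrable (torus_measure d) (\<lambda>\<eta>. \<Prod>j<d. poisson_disc (of_real r * \<zeta> j) (\<eta> j))" (is ?int)
    and "(LINT \<eta>|torus_measure d. (\<Prod>j<d. poisson_disc (of_real r * \<zeta> j) (\<eta> j))) = 1" (is ?eq)
proof -
  have z: "of_real r * \<zeta> j \<in> disc" if "j < d" for j
    using torus_coordinate[OF \<zeta> that] r by (simp add: norm_mult)
  have i: "integrable circle_measure (poisson_disc (of_real r * \<zeta> j))" if "j < d" for j
    using integrable_poisson_disc_mult[OF z[OF that], of "\<lambda>_. 1"] by simp
  show ?int unfolding torus_measure_def
    by (rule circle_product.product_integrable_prod) (auto intro: i)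
  show ?eq unfolding torus_measure_def
    using z by (subst circle_product.product_integral_prod) (auto intro: i simp: integral_poisson_disc)
qed

text \<open>The squared distance involves one coordinate only and is absorbed into the
  \<open>i\<close>-th factor. The integrand stays a product, and its integral is one second moment
  times masses equal to 1.\<close>

lemma integral_poisson_polydisc_dist_sq:
  assumes \<zeta>: "\<zeta> \<in> torus d" and r: "0 \<le> r" "r < 1" and i: "i < d"
  shows "integrable (torus_measure d)
      (\<lambda>\<eta>. (\<Prod>j<d. poisson_disc (of_real r * \<zeta> j) (\<eta> j)) * (norm (\<eta> i - \<zeta> i))\<^sup>2)" (is ?int)
    and "(LINT \<eta>|torus_measure d. (\<Prod>j<d. poisson_disc (of_real r * \<zeta> j) (\<eta> j)) * (norm (\<eta> i - \<zeta> i))\<^sup>2) =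
      2 - 2 * r" (is ?eq)
proof -
  define p where "p j w = poisson_disc (of_real r * \<zeta> j) w * (if j = i then (norm (w - \<zeta> i))\<^sup>2 else 1)" for j w
  have z: "of_real r * \<zeta> j \<in> disc" if "j < d" for j
    using torus_coordinate[OF \<zeta> that] r by (simp add: norm_mult)
  have pi: "integrable circle_measure (p j)" if "j < d" for j
    unfolding p_def
    by (intro integrable_poisson_disc_mult[OF z[OF that]]) (cases "j = i", auto intro!: continuous_intros)
  have eq: "(\<Prod>j<d. poisson_disc (of_real r * \<zeta> j) (\<eta> j)) * (norm (\<eta> i - \<zeta> i))\<^sup>2 = (\<Prod>j<d. p j (\<eta> j))" for \<eta>
    using i by (simp add: p_def prod.distrib prod.delta)
  show ?int unfolding eq torus_measure_def
    by (rule circle_product.product_integrable_prod) (auto intro: pi)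
  have "(LINT w|circle_measure. p j w) = (if j = i then 2 - 2 * r else 1)" if "j < d" for j
    using integral_poisson_disc_dist_sq[of "\<zeta> i" r] integral_poisson_disc[OF z[OF that]]
      torus_coordinate[OF \<zeta> that] r by (auto simp: p_def)
  then show ?eq unfolding eq torus_measure_def
    using i by (subst circle_product.product_integral_prod) (auto intro: pi simp: prod.delta)
qed

subsection \<open>Functions and integrals on the torus\<close>

text \<open>Extensionality pins the coordinates from \<open>d\<close> on to
  \<open>undefined\<close>. The torus is thus a full product over \<open>nat\<close> with circles
  and singletons as factors, and Tychonoff's theorem applies.\<close>

lemma compact_torus: "compact (torus d)"
proof -
  have "torus d = (\<Pi>\<^sub>E j\<in>UNIV. if j < d then circle else {undefined})"
    by (auto simp: torus_def PiE_def Pi_def extensional_def split: if_splits)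
  moreover have "compactin (product_topology (\<lambda>_. euclidean) UNIV)
      (\<Pi>\<^sub>E j\<in>UNIV. if j < d then circle else {undefined :: complex})"
    unfolding compactin_PiE by auto
  ultimately show ?thesis
    by (simp add: euclidean_product_topology)
qed

lemma continuous_on_torus_bounded:
  fixes f :: "(nat \<Rightarrow> complex) \<Rightarrow> complex"
  assumes "continuous_on (torus d) f"
  obtains B where "0 \<le> B" "\<And>\<zeta>. \<zeta> \<in> torus d \<Longrightarrow> norm (f \<zeta>) \<le> B"
proof -
  have "bounded (f ` torus d)"
    using assms by (intro compact_imp_bounded compact_continuous_image compact_torus)
  then obtain B where "\<forall>x\<in>f ` torus d. norm x \<le> B" by (auto simp: bounded_iff)
  then show thesis using that[of "max 0 B"] by force
qed

text \<open>A quadratic substitute for uniform continuity, in the form that Korovkin's argument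
  needs. Pairs with oscillation at least \<open>\<epsilon>\<close> form a compact set
  \<open>K\<close> off the diagonal. There \<open>D\<close> has a positive minimum, so a large
  multiple of it dominates the trivial bound \<open>2 * B\<close>.\<close>

lemma torus_continuity_modulus:
  fixes f :: "(nat \<Rightarrow> complex) \<Rightarrow> complex"
  assumes f: "continuous_on (torus d) f" and e: "0 < \<epsilon>"
  obtains C where "0 \<le> C" "\<And>\<zeta> \<eta>. \<zeta> \<in> torus d \<Longrightarrow> \<eta> \<in> torus d \<Longrightarrow>
    norm (f \<eta> - f \<zeta>) \<le> \<epsilon> + C * (\<Sum>j<d. (norm (\<eta> j - \<zeta> j))\<^sup>2)"
proof -
  let ?T = "torus d \<times> torus d"
  define D where "D p = (\<Sum>j<d. (norm (snd p j - fst p j))\<^sup>2)" for p :: "(nat \<Rightarrow> complex) \<times> (nat \<Rightarrow> complex)"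
  define G where "G p = norm (f (snd p) - f (fst p))" for p
  obtain B where B: "0 \<le> B" "\<And>\<zeta>. \<zeta> \<in> torus d \<Longrightarrow> norm (f \<zeta>) \<le> B"
    using continuous_on_torus_bounded[OF f] by blast
  have G2: "G p \<le> 2 * B" if "p \<in> ?T" for p
    unfolding G_def using that B(2)[of "fst p"] B(2)[of "snd p"]
      norm_triangle_ineq4[of "f (snd p)" "f (fst p)"] by (auto simp: mem_Times_iff)
  have D0: "0 \<le> D p" for p unfolding D_def by (intro sum_nonneg) auto
  have cG: "continuous_on ?T G"
    unfolding G_def
    by (intro continuous_intros continuous_on_compose2[OF f] ) auto
  have cD: "continuous_on ?T D"
    unfolding D_def
    by (intro continuous_intros continuous_on_compose2[OF continuous_on_coordinate[of UNIV]]) auto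
  define K where "K = {p \<in> ?T. \<epsilon> \<le> G p}"
  have "compact K"
  proof -
    have cT: "compact ?T" by (intro compact_Times compact_torus)
    have "closedin (top_of_set ?T) K"
      using continuous_closedin_preimage[OF cG, of "{\<epsilon>..}"]
      by (simp add: K_def vimage_def Int_def conj_commute)
    then show ?thesis using closedin_compact cT by blast
  qed
  have "\<exists>C\<ge>0. \<forall>p\<in>?T. G p \<le> \<epsilon> + C * D p"
  proof (cases "K = {}")
    case True
    then have "\<forall>p\<in>?T. G p \<le> \<epsilon> + 0 * D p" by (force simp: K_def)
    then show ?thesis by blast
  next
    case False
    have "continuous_on K D" using cD by (rule continuous_on_subset) (auto simp: K_def)
    then obtain q where q: "q \<in> K" "\<forall>p\<in>K. D q \<le> D p"
      using continuous_attains_inf[OF \<open>compact K\<close> False] by blast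
    have "D q \<noteq> 0"
    proof
      assume "D q = 0"
      then have "\<forall>j<d. snd q j = fst q j"
        unfolding D_def by (subst (asm) sum_nonneg_eq_0_iff) auto
      moreover have "q \<in> ?T" using q by (simp add: K_def)
      ultimately have "snd q = fst q"
        unfolding torus_def mem_Times_iff by (intro PiE_ext[of _ "{..<d}" "\<lambda>_. circle"]) auto
      then have "G q = 0" by (simp add: G_def)
      then show False using q e by (simp add: K_def)
    qed
    then have Dq: "0 < D q" using D0[of q] by simp
    have "G p \<le> \<epsilon> + 2 * B / D q * D p" if p: "p \<in> ?T" for p
    proof (cases "p \<in> K")
      case True
      have "2 * B * 1 \<le> 2 * B * (D p / D q)"
        using q(2) True Dq B(1) by (intro mult_left_mono) auto
      then show ?thesis using G2[OF p] e by simp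
    next
      case False
      have "0 \<le> 2 * B / D q * D p" using B(1) Dq D0 by simp
      with False p show ?thesis by (auto simp: K_def)
    qed
    then show ?thesis using B(1) Dq by (intro exI[of _ "2 * B / D q"]) auto
  qed
  then obtain C where "0 \<le> C" "\<forall>p\<in>?T. G p \<le> \<epsilon> + C * D p" by blast
  then show thesis using that[of C] by (force simp: G_def D_def)
qed

text \<open>The product sigma-algebra knows only the coordinates below \<open>d\<close>, the Borel
  one those for all of \<open>nat\<close>. On extensional functions the remaining coordinates are
  constant.\<close>

lemma torus_measure_to_borel: "(\<lambda>\<zeta>. \<zeta>) \<in> torus_measure d \<rightarrow>\<^sub>M restrict_space borel (torus d)"
proof (rule measurable_restrict_space2)
  show "(\<lambda>\<zeta>. \<zeta>) \<in> borel_measurable (torus_measure d)"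
  proof (rule measurable_coordinatewise_then_product)
    fix j :: nat
    show "(\<lambda>\<zeta>. \<zeta> j) \<in> borel_measurable (torus_measure d)"
    proof (cases "j < d")
      case True then show ?thesis by (intro circle_measurable_borel coordinate_measurable_torus)
    next
      case False
      then have "\<zeta> j = undefined" if "\<zeta> \<in> space (torus_measure d)" for \<zeta>
        using that by (auto simp: torus_def PiE_def extensional_def)
      then show ?thesis by (subst measurable_cong[where g = "\<lambda>_. undefined"]) auto
    qed
  qed
qed auto

lemma continuous_on_torus_measurable:
  fixes f :: "(nat \<Rightarrow> complex) \<Rightarrow> complex"
  assumes "continuous_on (torus d) f"
  shows "f \<in> borel_measurable (torus_measure d)"
  using measurable_compose[OF torus_measure_to_borel borel_measurable_continuous_on_restrict[OF assms]] by simp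

section \<open>Iterated integrals and Fubini\<close>

lemma integrable_torus_bounded:
  fixes G :: "(nat \<Rightarrow> complex) \<Rightarrow> complex"
  assumes "G \<in> borel_measurable (torus_measure d)" "\<And>\<zeta>. \<zeta> \<in> torus d \<Longrightarrow> norm (G \<zeta>) \<le> B"
  shows "integrable (torus_measure d) G"
  using assms by (intro torus_measure.integrable_const_bound[where B = B] AE_I2) auto

lemma integral_torus_Suc:
  fixes G :: "(nat \<Rightarrow> complex) \<Rightarrow> complex"
  assumes "G \<in> borel_measurable (torus_measure (Suc n))" "\<And>\<zeta>. \<zeta> \<in> torus (Suc n) \<Longrightarrow> norm (G \<zeta>) \<le> B"
  shows "(LINT \<zeta>|torus_measure (Suc n). G \<zeta>) =
    (LINT \<zeta>|torus_measure n. LINT w|circle_measure. G (\<zeta>(n := w)))"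
  using circle_product.product_integral_insert[of "{..<n}" n G] integrable_torus_bounded[OF assms]
  by (simp add: torus_measure_def lessThan_Suc)

lemma torus_upd: "\<zeta> \<in> torus n \<Longrightarrow> norm w = 1 \<Longrightarrow> \<zeta>(n := w) \<in> torus (Suc n)"
  by (auto simp: torus_def PiE_def Pi_def extensional_def less_Suc_eq)

text \<open>It applies to functions not known to be measurable: without integrability the integral
  is 0 by convention, which \<open>0 \<le> B\<close> covers.\<close>

lemma (in finite_measure) norm_integral_le_const:
  fixes g :: "'a \<Rightarrow> complex"
  assumes "\<And>x. x \<in> space M \<Longrightarrow> norm (g x) \<le> B" "0 \<le> B"
  shows "norm (LINT x|M. g x) \<le> measure M (space M) * B"
proof (cases "integrable M g")
  case True
  have "norm (LINT x|M. g x) \<le> (LINT x|M. norm (g x))" by (rule integral_norm_bound)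
  also have "\<dots> \<le> (LINT x|M. B)"
    using assms True by (intro integral_mono) auto
  finally show ?thesis by simp
next
  case False
  then show ?thesis using assms by (simp add: not_integrable_integral_eq)
qed

lemma upd_integral_measurable:
  assumes "H \<in> borel_measurable (torus_measure (Suc n))"
  shows "(\<lambda>\<zeta>. LINT w|circle_measure. H (\<zeta>(n := w)) :: complex) \<in> borel_measurable (torus_measure n)"
  using measurable_compose[OF upd_measurable_torus assms]
  by (intro circle_measure.borel_measurable_lebesgue_integral) (simp add: case_prod_unfold)

text \<open>The bound \<open>B\<close> survives each integration because the circle has mass 1, so
  Fubini applies at every level.\<close>

lemma iterated_circle_integral_eq:
  assumes "G \<in> borel_measurable (torus_measure n)" "\<And>\<zeta>. \<zeta> \<in> torus n \<Longrightarrow> norm (G \<zeta>) \<le> B" "0 \<le> B"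
  shows "iterated_circle_integral n G = (LINT \<zeta>|torus_measure n. G \<zeta>)"
  using assms
proof (induction n arbitrary: G)
  case 0
  \<comment> \<open>The empty product measure is a unit mass at
    \<open>\<lambda>_. undefined\<close>, the point at which \<open>iterated_circle_integral\<close>
    evaluates.\<close>
  then show ?case by (simp add: torus_measure_def PiM_empty lebesgue_integral_count_space_finite)
next
  case (Suc n)
  have "(\<lambda>\<zeta>. LINT w|circle_measure. G (\<zeta>(n := w))) \<in> borel_measurable (torus_measure n)"
    by (rule upd_integral_measurable[OF Suc.prems(1)])
  moreover have "norm (LINT w|circle_measure. G (\<zeta>(n := w))) \<le> B" if "\<zeta> \<in> torus n" for \<zeta>
  proof -
    have "norm (LINT w|circle_measure. G (\<zeta>(n := w))) \<le> measure circle_measure (space circle_measure) * B"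
      by (intro circle_measure.norm_integral_le_const Suc.prems(2) torus_upd that Suc.prems(3)) simp
    then show ?thesis by (simp only: circle_measure.prob_space mult_1)
  qed
  ultimately have "iterated_circle_integral (Suc n) G =
      (LINT \<zeta>|torus_measure n. LINT w|circle_measure. G (\<zeta>(n := w)))"
    using Suc by simp
  also have "\<dots> = (LINT \<zeta>|torus_measure (Suc n). G \<zeta>)"
    using Suc.prems by (intro integral_torus_Suc[symmetric]) auto
  finally show ?case .
qed

lemma integral_swap_bounded:
  fixes f :: "'a \<Rightarrow> 'b \<Rightarrow> complex"
  assumes "finite_measure M" "finite_measure N"
    and f: "(\<lambda>(x, y). f x y) \<in> borel_measurable (M \<Otimes>\<^sub>M N)"
    and B: "\<And>x y. x \<in> space M \<Longrightarrow> y \<in> space N \<Longrightarrow> norm (f x y) \<le> B"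
  shows "(LINT x|M. LINT y|N. f x y) = (LINT y|N. LINT x|M. f x y)"
proof -
  interpret M: finite_measure M by fact
  interpret N: finite_measure N by fact
  interpret pair_sigma_finite M N ..
  interpret MN: finite_measure "M \<Otimes>\<^sub>M N"
    by (intro finite_measure_pair_measure assms)
  have "integrable (M \<Otimes>\<^sub>M N) (\<lambda>(x, y). f x y)"
    using f B by (intro MN.integrable_const_bound[of _ B] AE_I2) (auto simp: space_pair_measure)
  then show ?thesis by (rule Fubini_integral[symmetric])
qed

text \<open>Korovkin's argument: a kernel of mass 1 with small second moment reproduces a value approximately.\<close>

lemma kernel_average_error:
  fixes g :: "'a \<Rightarrow> complex" and k D :: "'a \<Rightarrow> real"
  assumes k: "integrable M k" "(LINT x|M. k x) = 1" "\<And>x. x \<in> space M \<Longrightarrow> 0 \<le> k x"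
    and kD: "integrable M (\<lambda>x. k x * D x)" "(LINT x|M. k x * D x) = \<delta>"
    and g: "g \<in> borel_measurable M" "\<And>x. x \<in> space M \<Longrightarrow> norm (g x) \<le> B"
    and close: "\<And>x. x \<in> space M \<Longrightarrow> norm (g x - a) \<le> \<epsilon> + C * D x"
  shows "norm ((LINT x|M. of_real (k x) * g x) - a) \<le> \<epsilon> + C * \<delta>"
proof -
  have kg: "integrable M (\<lambda>x. of_real (k x) * g x)"
    by (rule Bochner_Integration.integrable_bound[where f = "\<lambda>x. k x * B"])
       (use k g in \<open>auto intro!: AE_I2 mult_left_mono order_trans[OF _ abs_ge_self] simp: norm_mult abs_mult\<close>)
  have ka: "integrable M (\<lambda>x. of_real (k x) * a)"
    using k(1) by simp
  \<comment> \<open>Since the kernel has mass 1, \<open>a\<close> is itself a kernel average, and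
    the error becomes an average of \<open>g x - a\<close>.\<close>
  have "(LINT x|M. of_real (k x) * g x) - a = (LINT x|M. of_real (k x) * g x) - (LINT x|M. of_real (k x) * a)"
    using k by (simp add: integral_of_real)
  also have "\<dots> = (LINT x|M. of_real (k x) * (g x - a))"
    using kg ka by (simp add: algebra_simps)
  also have "norm \<dots> \<le> (LINT x|M. norm (of_real (k x) * (g x - a)))"
    by (rule integral_norm_bound)
  also have "\<dots> \<le> (LINT x|M. \<epsilon> * k x + C * (k x * D x))"
  proof (intro integral_mono)
    show "integrable M (\<lambda>x. norm (of_real (k x) * (g x - a)))"
      using Bochner_Integration.integrable_diff[OF kg ka] by (intro integrable_norm) (simp add: algebra_simps)
    show "integrable M (\<lambda>x. \<epsilon> * k x + C * (k x * D x))"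
      using k kD by simp
    fix x assume x: "x \<in> space M"
    have "norm (of_real (k x) * (g x - a)) \<le> k x * (\<epsilon> + C * D x)"
      using k(3)[OF x] close[OF x] by (simp add: norm_mult mult_left_mono)
    then show "norm (of_real (k x) * (g x - a)) \<le> \<epsilon> * k x + C * (k x * D x)"
      by (simp add: algebra_simps)
  qed
  also have "\<dots> = \<epsilon> + C * \<delta>"
    using k kD by simp
  finally show ?thesis .
qed

lemma (in finite_measure) norm_integral_diff_le:
  fixes g h :: "'a \<Rightarrow> complex"
  assumes "integrable M g" "integrable M h"
    and "\<And>x. x \<in> space M \<Longrightarrow> norm (g x - h x) \<le> e" "0 \<le> e"
  shows "norm ((LINT x|M. g x) - (LINT x|M. h x)) \<le> measure M (space M) * e"
  using norm_integral_le_const[of "\<lambda>x. g x - h x" e] assms by simp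

subsection \<open>Clark measures\<close>

lemma space_torus_borel:
  "sets \<tau> = sets (restrict_space borel (torus d)) \<Longrightarrow> space \<tau> = torus d"
  using sets_eq_imp_space_eq[of \<tau>] by (force simp: space_restrict_space)

lemma space_circle_borel:
  "sets \<sigma> = sets (restrict_space borel circle) \<Longrightarrow> space \<sigma> = circle"
  using sets_eq_imp_space_eq[of \<sigma>] by (force simp: space_restrict_space)

lemma finite_measure_clark_disc:
  assumes "clark_measure_disc \<phi> \<alpha> \<sigma>"
  shows "finite_measure \<sigma>"
proof
  have space: "space \<sigma> = circle"
    using assms by (intro space_circle_borel) (simp add: clark_measure_disc_def)
  have "emeasure \<sigma> (space \<sigma>) = (\<integral>\<^sup>+x. ennreal (poisson_disc 0 x) \<partial>\<sigma>)"
    by (subst nn_integral_cong[where v = "\<lambda>_. 1"]) (auto simp: space poisson_disc_def)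
  also have "\<dots> < \<infinity>"
    using assms by (auto simp: clark_measure_disc_def)
  finally show "emeasure \<sigma> (space \<sigma>) \<noteq> \<infinity>" by simp
qed

lemma finite_measure_clark_polydisc:
  assumes "clark_measure_polydisc d F \<alpha> \<tau>"
  shows "finite_measure \<tau>"
proof
  let ?z = "\<lambda>j\<in>{..<d}. 0 :: complex"
  have space: "space \<tau> = torus d"
    using assms by (intro space_torus_borel) (simp add: clark_measure_polydisc_def)
  have "emeasure \<tau> (space \<tau>) = (\<integral>\<^sup>+x. ennreal (poisson_polydisc d ?z x) \<partial>\<tau>)"
    by (subst nn_integral_cong[where v = "\<lambda>_. 1"])
       (auto simp: space poisson_polydisc_def poisson_disc_def torus_coordinate)
  also have "?z \<in> polydisc d" by (auto simp: polydisc_def)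
  then have "(\<integral>\<^sup>+x. ennreal (poisson_polydisc d ?z x) \<partial>\<tau>) < \<infinity>"
    using assms by (auto simp: clark_measure_polydisc_def)
  finally show "emeasure \<tau> (space \<tau>) \<noteq> \<infinity>" by simp
qed

lemma prod_poisson_disc_bounds:
  assumes "\<zeta> \<in> torus d" "\<eta> \<in> torus d" "0 \<le> r" "r < 1"
  shows "0 \<le> (\<Prod>j<d. poisson_disc (of_real r * \<zeta> j) (\<eta> j))"
    and "(\<Prod>j<d. poisson_disc (of_real r * \<zeta> j) (\<eta> j)) \<le> (1 / (1 - r)\<^sup>2) ^ d"
proof -
  have nn: "0 \<le> poisson_disc (of_real r * \<zeta> j) (\<eta> j)" if "j < d" for j
    using assms torus_coordinate that by (intro poisson_disc_nonneg) (simp add: norm_mult)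
  have le: "poisson_disc (of_real r * \<zeta> j) (\<eta> j) \<le> 1 / (1 - r)\<^sup>2" if "j < d" for j
    using assms torus_coordinate that by (intro poisson_disc_le) (auto simp: norm_mult)
  show "0 \<le> (\<Prod>j<d. poisson_disc (of_real r * \<zeta> j) (\<eta> j))"
    using nn by (intro prod_nonneg) auto
  have "(\<Prod>j<d. poisson_disc (of_real r * \<zeta> j) (\<eta> j)) \<le> (\<Prod>j<d. 1 / (1 - r)\<^sup>2)"
    using nn le by (intro prod_mono) auto
  then show "(\<Prod>j<d. poisson_disc (of_real r * \<zeta> j) (\<eta> j)) \<le> (1 / (1 - r)\<^sup>2) ^ d"
    by simp
qed

lemma coordinate_borel_measurable_torus [measurable]:
  "j < d \<Longrightarrow> (\<lambda>\<zeta>. \<zeta> j) \<in> borel_measurable (torus_measure d)"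
  by (intro circle_measurable_borel coordinate_measurable_torus)

lemma borel_measurable_continuous_on_torus:
  fixes g :: "(nat \<Rightarrow> complex) \<Rightarrow> complex"
  assumes "sets \<tau> = sets (restrict_space borel (torus d))" "continuous_on (torus d) g"
  shows "g \<in> borel_measurable \<tau>"
  using borel_measurable_continuous_on_restrict[OF assms(2)]
  by (subst measurable_cong_sets[OF assms(1) refl])

lemma borel_measurable_circle_ident:
  assumes "sets \<sigma> = sets (restrict_space borel circle)"
  shows "(\<lambda>x. x) \<in> borel_measurable \<sigma>"
  by (subst measurable_cong_sets[OF assms refl])
     (intro borel_measurable_continuous_on_restrict continuous_intros)

section \<open>The Poisson extension tested against a measure on the torus\<close>

context
  fixes d :: nat and \<tau> :: "(nat \<Rightarrow> complex) measure" and f :: "(nat \<Rightarrow> complex) \<Rightarrow> complex"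
  assumes fin: "finite_measure \<tau>" and sets_\<tau>: "sets \<tau> = sets (restrict_space borel (torus d))"
    and f: "continuous_on (torus d) f"
begin

interpretation \<tau>: finite_measure \<tau> by (rule fin)

lemma prod_poisson_kernel_measurable:
  "(\<lambda>(\<zeta>, \<eta>). of_real (\<Prod>j<d. poisson_disc (of_real r * \<zeta> j) (\<eta> j)) * f \<eta>)
    \<in> borel_measurable (\<tau> \<Otimes>\<^sub>M torus_measure d)"
proof -
  have [measurable]: "(\<lambda>\<zeta>. \<zeta> j) \<in> borel_measurable \<tau>" for j
    by (intro borel_measurable_continuous_on_torus[OF sets_\<tau>] continuous_on_coordinate)
  have [measurable]: "f \<in> borel_measurable (torus_measure d)"
    using f by (rule continuous_on_torus_measurable)
  have "(\<lambda>p. poisson_disc (of_real r * fst p j) (snd p j)) \<in> borel_measurable (\<tau> \<Otimes>\<^sub>M torus_measure d)"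
    if "j \<in> {..<d}" for j
    using that by (intro poisson_disc_measurable) auto
  then have [measurable]: "(\<lambda>p. \<Prod>j<d. poisson_disc (of_real r * fst p j) (snd p j)) \<in> borel_measurable (\<tau> \<Otimes>\<^sub>M torus_measure d)"
    by (rule borel_measurable_prod)
  show ?thesis unfolding case_prod_unfold by measurable
qed

text \<open>Korovkin's estimate at each \<open>\<zeta>\<close> uses the sum of the \<open>d\<close>
  coordinate moments, and \<open>\<tau>\<close> contributes only its total mass. As \<open>r\<close>
  tends to 1 the bound tends to a multiple of \<open>\<epsilon>\<close>.\<close>

lemma poisson_extension_error:
  assumes r: "0 \<le> r" "r < 1" and C: "0 \<le> C" "0 \<le> \<epsilon>"
    and mod: "\<And>\<zeta> \<eta>. \<zeta> \<in> torus d \<Longrightarrow> \<eta> \<in> torus d \<Longrightarrow>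
      norm (f \<eta> - f \<zeta>) \<le> \<epsilon> + C * (\<Sum>j<d. (norm (\<eta> j - \<zeta> j))\<^sup>2)"
  shows "norm ((LINT \<zeta>|\<tau>. LINT \<eta>|torus_measure d.
        of_real (\<Prod>j<d. poisson_disc (of_real r * \<zeta> j) (\<eta> j)) * f \<eta>) - (LINT \<zeta>|\<tau>. f \<zeta>))
    \<le> measure \<tau> (space \<tau>) * (\<epsilon> + C * (of_nat d * (2 - 2 * r)))"
proof -
  let ?E = "\<epsilon> + C * (of_nat d * (2 - 2 * r))"
  let ?F = "\<lambda>\<zeta>. LINT \<eta>|torus_measure d. of_real (\<Prod>j<d. poisson_disc (of_real r * \<zeta> j) (\<eta> j)) * f \<eta>"
  obtain B where B: "0 \<le> B" "\<And>\<zeta>. \<zeta> \<in> torus d \<Longrightarrow> norm (f \<zeta>) \<le> B"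
    using continuous_on_torus_bounded[OF f] by blast
  have E: "0 \<le> ?E" using r C by simp
  have close: "norm (?F \<zeta> - f \<zeta>) \<le> ?E" if \<zeta>: "\<zeta> \<in> torus d" for \<zeta>
  proof (rule kernel_average_error[where D = "\<lambda>\<eta>. \<Sum>j<d. (norm (\<eta> j - \<zeta> j))\<^sup>2" and B = B])
    show "integrable (torus_measure d) (\<lambda>\<eta>. (\<Prod>j<d. poisson_disc (of_real r * \<zeta> j) (\<eta> j)) *
        (\<Sum>j<d. (norm (\<eta> j - \<zeta> j))\<^sup>2))"
      unfolding sum_distrib_left
      using integral_poisson_polydisc_dist_sq(1)[OF \<zeta> r] by (intro Bochner_Integration.integrable_sum) simp
    show "(LINT \<eta>|torus_measure d. (\<Prod>j<d. poisson_disc (of_real r * \<zeta> j) (\<eta> j)) *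
        (\<Sum>j<d. (norm (\<eta> j - \<zeta> j))\<^sup>2)) = of_nat d * (2 - 2 * r)"
      unfolding sum_distrib_left
      using integral_poisson_polydisc_dist_sq[OF \<zeta> r] by (subst Bochner_Integration.integral_sum) auto
  qed (use \<zeta> r B mod in \<open>auto intro: integral_poisson_polydisc prod_poisson_disc_bounds
      continuous_on_torus_measurable[OF f]\<close>)
  have "?F \<in> borel_measurable \<tau>"
    by (intro torus_measure.borel_measurable_lebesgue_integral prod_poisson_kernel_measurable)
  moreover have "norm (?F \<zeta>) \<le> B + ?E" if "\<zeta> \<in> torus d" for \<zeta>
    using close[OF that] B(2)[OF that] norm_triangle_ineq[of "?F \<zeta> - f \<zeta>" "f \<zeta>"] by simp
  ultimately have "integrable \<tau> ?F"
    by (intro \<tau>.integrable_const_bound[of _ "B + ?E"] AE_I2) (auto simp: space_torus_borel[OF sets_\<tau>])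
  moreover have "integrable \<tau> f"
    using B borel_measurable_continuous_on_torus[OF sets_\<tau> f]
    by (intro \<tau>.integrable_const_bound[of _ B] AE_I2) (auto simp: space_torus_borel[OF sets_\<tau>])
  ultimately show ?thesis
    using close E by (intro \<tau>.norm_integral_diff_le) (auto simp: space_torus_borel[OF sets_\<tau>])
qed

text \<open>After Fubini, the symmetry of each factor moves the dilation from \<open>\<zeta>\<close>
  to \<open>\<eta>\<close>. The measure then enters only through its Poisson integral
  \<open>U\<close>, the quantity that the Clark identity prescribes.\<close>

lemma poisson_extension_swap:
  assumes r: "0 \<le> r" "r < 1"
    and U: "\<And>z. z \<in> polydisc d \<Longrightarrow> (LINT \<zeta>|\<tau>. poisson_polydisc d z \<zeta>) = U z"
  shows "(LINT \<zeta>|\<tau>. LINT \<eta>|torus_measure d.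
        of_real (\<Prod>j<d. poisson_disc (of_real r * \<zeta> j) (\<eta> j)) * f \<eta>) =
    (LINT \<eta>|torus_measure d. of_real (U (\<lambda>j\<in>{..<d}. of_real r * \<eta> j)) * f \<eta>)"
proof -
  obtain B where B: "0 \<le> B" "\<And>\<zeta>. \<zeta> \<in> torus d \<Longrightarrow> norm (f \<zeta>) \<le> B"
    using continuous_on_torus_bounded[OF f] by blast
  have "(LINT \<zeta>|\<tau>. LINT \<eta>|torus_measure d.
        of_real (\<Prod>j<d. poisson_disc (of_real r * \<zeta> j) (\<eta> j)) * f \<eta>) =
      (LINT \<eta>|torus_measure d. LINT \<zeta>|\<tau>.
        of_real (\<Prod>j<d. poisson_disc (of_real r * \<zeta> j) (\<eta> j)) * f \<eta>)"
  proof (rule integral_swap_bounded[OF fin _ prod_poisson_kernel_measurable])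
    show "finite_measure (torus_measure d)" by (rule torus_measure.finite_measure_axioms)
    fix \<zeta> \<eta> assume "\<zeta> \<in> space \<tau>" "\<eta> \<in> space (torus_measure d)"
    then show "norm (of_real (\<Prod>j<d. poisson_disc (of_real r * \<zeta> j) (\<eta> j)) * f \<eta>) \<le> (1 / (1 - r)\<^sup>2) ^ d * B"
      using B r prod_poisson_disc_bounds[of \<zeta> d \<eta> r] unfolding norm_mult norm_of_real
      by (intro mult_mono) (auto simp: space_torus_borel[OF sets_\<tau>])
  qed
  also have "\<dots> = (LINT \<eta>|torus_measure d. of_real (U (\<lambda>j\<in>{..<d}. of_real r * \<eta> j)) * f \<eta>)"
  proof (intro Bochner_Integration.integral_cong refl)
    fix \<eta> assume "\<eta> \<in> space (torus_measure d)"
    then have \<eta>: "\<eta> \<in> torus d" by simp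
    have z: "(\<lambda>j\<in>{..<d}. of_real r * \<eta> j) \<in> polydisc d"
      using torus_coordinate[OF \<eta>] r by (auto simp: polydisc_def norm_mult)
    have "(\<Prod>j<d. poisson_disc (of_real r * \<zeta> j) (\<eta> j)) =
        poisson_polydisc d (\<lambda>j\<in>{..<d}. of_real r * \<eta> j) \<zeta>" if "\<zeta> \<in> space \<tau>" for \<zeta>
      unfolding poisson_polydisc_dilation
      using that torus_coordinate \<eta>
      by (intro prod.cong poisson_disc_swap refl) (auto simp: space_torus_borel[OF sets_\<tau>])
    then have "(LINT \<zeta>|\<tau>. complex_of_real (\<Prod>j<d. poisson_disc (of_real r * \<zeta> j) (\<eta> j))) =
        (LINT \<zeta>|\<tau>. complex_of_real (poisson_polydisc d (\<lambda>j\<in>{..<d}. of_real r * \<eta> j) \<zeta>))"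
      by (intro Bochner_Integration.integral_cong refl arg_cong[where f = complex_of_real])
    also have "\<dots> = of_real (U (\<lambda>j\<in>{..<d}. of_real r * \<eta> j))"
      using U[OF z] by (simp del: restrict_apply)
    finally have "(LINT \<zeta>|\<tau>. complex_of_real (\<Prod>j<d. poisson_disc (of_real r * \<zeta> j) (\<eta> j))) =
        of_real (U (\<lambda>j\<in>{..<d}. of_real r * \<eta> j))" .
    then show "(LINT \<zeta>|\<tau>. of_real (\<Prod>j<d. poisson_disc (of_real r * \<zeta> j) (\<eta> j)) * f \<eta>) =
        of_real (U (\<lambda>j\<in>{..<d}. of_real r * \<eta> j)) * f \<eta>"
      by (simp only: integral_mult_left_zero)
  qed
  finally show ?thesis .
qed

end

section \<open>Poisson averages over the last coordinate\<close>

context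
  fixes n :: nat and \<sigma> :: "complex measure" and f :: "(nat \<Rightarrow> complex) \<Rightarrow> complex"
  assumes fin: "finite_measure \<sigma>" and sets_\<sigma>: "sets \<sigma> = sets (restrict_space borel circle)"
    and f: "continuous_on (torus (Suc n)) f"
begin

interpretation \<sigma>: finite_measure \<sigma> by (rule fin)

text \<open>The new last coordinate has modulus 1, so the map factors through the product of
  \<open>torus_measure n\<close> and \<open>circle_measure\<close>.\<close>

lemma antidiagonal_measurable:
  "(\<lambda>(\<zeta>, x). f (\<zeta>(n := x * cnj (\<Prod>j<n. \<zeta> j)))) \<in> borel_measurable (torus_measure n \<Otimes>\<^sub>M \<sigma>)"
proof -
  note [measurable] = borel_measurable_circle_ident[OF sets_\<sigma>]
  have [measurable]: "(\<lambda>\<zeta>. \<Prod>j<n. \<zeta> j) \<in> borel_measurable (torus_measure n)"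
    by (intro borel_measurable_prod coordinate_borel_measurable_torus) auto
  have "cnj \<in> borel_measurable borel"
    by (intro borel_measurable_continuous_onI continuous_intros)
  note [measurable] = this
  have 1: "(\<lambda>p. snd p * cnj (\<Prod>j<n. fst p j)) \<in> torus_measure n \<Otimes>\<^sub>M \<sigma> \<rightarrow>\<^sub>M circle_measure"
    unfolding measurable_cong_sets[OF refl sets_circle_measure]
  proof (rule measurable_restrict_space2)
    show "(\<lambda>p. snd p * cnj (\<Prod>j<n. fst p j)) \<in> borel_measurable (torus_measure n \<Otimes>\<^sub>M \<sigma>)"
      using measurable_compose[OF measurable_fst \<open>(\<lambda>\<zeta>. \<Prod>j<n. \<zeta> j) \<in> borel_measurable (torus_measure n)\<close>]
      by measurable
  qed (auto simp: space_pair_measure space_circle_borel[OF sets_\<sigma>] norm_mult torus_prod_circle simp del: cnj_prod)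
  have "(\<lambda>p. (fst p, snd p * cnj (\<Prod>j<n. fst p j))) \<in> torus_measure n \<Otimes>\<^sub>M \<sigma> \<rightarrow>\<^sub>M torus_measure n \<Otimes>\<^sub>M circle_measure"
    using 1 by (intro measurable_Pair measurable_fst)
  from measurable_compose[OF measurable_compose[OF this upd_measurable_torus] continuous_on_torus_measurable[OF f]]
  show ?thesis by (simp add: case_prod_unfold)
qed

text \<open>With the first \<open>n\<close> coordinates fixed and \<open>c\<close> their product,
  the integral over the last one is exchanged with that over \<open>\<sigma>\<close>. Rotation
  directs the kernel towards \<open>x * cnj c\<close>. Only one coordinate is averaged, with second
  moment \<open>2 - 2 * \<rho>\<close>, and \<open>\<sigma>\<close> contributes its mass.\<close>

lemma poisson_average_error:
  assumes \<rho>: "0 \<le> \<rho>" "\<rho> < 1" and C: "0 \<le> C" "0 \<le> \<epsilon>"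
    and mod: "\<And>\<zeta> \<eta>. \<zeta> \<in> torus (Suc n) \<Longrightarrow> \<eta> \<in> torus (Suc n) \<Longrightarrow>
      norm (f \<eta> - f \<zeta>) \<le> \<epsilon> + C * (\<Sum>j<Suc n. (norm (\<eta> j - \<zeta> j))\<^sup>2)"
  shows "norm ((LINT \<eta>|torus_measure (Suc n).
        of_real (LINT x|\<sigma>. poisson_disc (of_real \<rho> * (\<Prod>j<Suc n. \<eta> j)) x) * f \<eta>) -
      iterated_circle_integral n (\<lambda>\<zeta>. LINT x|\<sigma>. f (\<zeta>(n := x * cnj (\<Prod>j<n. \<zeta> j)))))
    \<le> measure \<sigma> (space \<sigma>) * (\<epsilon> + C * (2 - 2 * \<rho>))"
proof -
  let ?E = "\<epsilon> + C * (2 - 2 * \<rho>)" and ?S = "measure \<sigma> (space \<sigma>)"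
  let ?K = "1 / (1 - \<rho>)\<^sup>2"
  define H where "H \<eta> = of_real (LINT x|\<sigma>. poisson_disc (of_real \<rho> * (\<Prod>j<Suc n. \<eta> j)) x) * f \<eta>" for \<eta>
  \<comment> \<open>\<open>A\<close> integrates out the last coordinate of \<open>H\<close>, and
    \<open>G\<close> is its limit as \<open>\<rho>\<close> tends to 1; the estimate is made
    pointwise in the other coordinates.\<close>
  define A where "A \<zeta> = (LINT w|circle_measure. H (\<zeta>(n := w)))" for \<zeta>
  define G where "G \<zeta> = (LINT x|\<sigma>. f (\<zeta>(n := x * cnj (\<Prod>j<n. \<zeta> j))))" for \<zeta>
  note [measurable] = continuous_on_torus_measurable[OF f] borel_measurable_circle_ident[OF sets_\<sigma>]
  obtain B where B: "0 \<le> B" "\<And>\<zeta>. \<zeta> \<in> torus (Suc n) \<Longrightarrow> norm (f \<zeta>) \<le> B"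
    using continuous_on_torus_bounded[OF f] by blast
  have E: "0 \<le> ?E" using \<rho> C by simp
  have anti: "\<zeta>(n := x * cnj (\<Prod>j<n. \<zeta> j)) \<in> torus (Suc n)" if "\<zeta> \<in> torus n" "x \<in> circle" for \<zeta> x
    using that torus_prod_circle by (intro torus_upd) (auto simp: norm_mult simp del: cnj_prod)

  have G_meas: "G \<in> borel_measurable (torus_measure n)"
    unfolding G_def by (intro \<sigma>.borel_measurable_lebesgue_integral antidiagonal_measurable)
  have G_bound: "norm (G \<zeta>) \<le> ?S * B" if "\<zeta> \<in> torus n" for \<zeta>
    unfolding G_def using B anti[OF that] by (intro \<sigma>.norm_integral_le_const) (auto simp: space_circle_borel[OF sets_\<sigma>])

  have H_meas: "H \<in> borel_measurable (torus_measure (Suc n))"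
  proof -
    have [measurable]: "(\<lambda>\<eta>. \<Prod>j<Suc n. \<eta> j) \<in> borel_measurable (torus_measure (Suc n))"
      by (intro borel_measurable_prod coordinate_borel_measurable_torus) auto
    have "(\<lambda>p. poisson_disc (of_real \<rho> * (\<Prod>j<Suc n. fst p j)) (snd p))
        \<in> borel_measurable (torus_measure (Suc n) \<Otimes>\<^sub>M \<sigma>)"
      using measurable_compose[OF measurable_fst \<open>(\<lambda>\<eta>. \<Prod>j<Suc n. \<eta> j) \<in> _\<close>]
        measurable_compose[OF measurable_snd borel_measurable_circle_ident[OF sets_\<sigma>]]
      by (intro poisson_disc_measurable borel_measurable_times) auto
    then have "(\<lambda>\<eta>. LINT x|\<sigma>. poisson_disc (of_real \<rho> * (\<Prod>j<Suc n. \<eta> j)) x)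
        \<in> borel_measurable (torus_measure (Suc n))"
      by (intro \<sigma>.borel_measurable_lebesgue_integral) (simp add: case_prod_unfold del: prod.lessThan_Suc)
    from borel_measurable_times[OF measurable_compose[OF this borel_measurable_of_real] continuous_on_torus_measurable[OF f]]
    show ?thesis by (simp only: H_def[abs_def])
  qed
  have pd: "norm (complex_of_real (poisson_disc (of_real \<rho> * c) x)) \<le> ?K" if "norm c = 1" "norm x = 1" for c x
    using poisson_disc_le[of "of_real \<rho> * c" \<rho> x] poisson_disc_nonneg[of "of_real \<rho> * c" x] \<rho> that
    by (simp add: norm_mult)
  have H_bound: "norm (H \<eta>) \<le> ?S * ?K * B" if "\<eta> \<in> torus (Suc n)" for \<eta>
  proof -
    have "norm (complex_of_real (LINT x|\<sigma>. poisson_disc (of_real \<rho> * (\<Prod>j<Suc n. \<eta> j)) x)) \<le> ?S * ?K"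
      unfolding integral_complex_of_real[symmetric]
      using pd[OF torus_prod_circle[OF that]] by (intro \<sigma>.norm_integral_le_const) (auto simp: space_circle_borel[OF sets_\<sigma>])
    then show ?thesis unfolding H_def norm_mult
      using B that by (intro mult_mono) auto
  qed
  have A_meas: "A \<in> borel_measurable (torus_measure n)"
    unfolding A_def by (rule upd_integral_measurable[OF H_meas])
  have A_bound: "norm (A \<zeta>) \<le> ?S * ?K * B" if "\<zeta> \<in> torus n" for \<zeta>
    using circle_measure.norm_integral_le_const[of "\<lambda>w. H (\<zeta>(n := w))" "?S * ?K * B"]
      H_bound torus_upd[OF that] B(1) circle_measure.prob_space
    unfolding A_def by simp

  have close: "norm (A \<zeta> - G \<zeta>) \<le> ?S * ?E" if \<zeta>: "\<zeta> \<in> torus n" for \<zeta>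
  proof -
    define c where "c = (\<Prod>j<n. \<zeta> j)"
    have c: "norm c = 1" unfolding c_def using \<zeta> by (rule torus_prod_circle)
    have fc_meas [measurable]: "(\<lambda>w. f (\<zeta>(n := w))) \<in> borel_measurable circle_measure"
    proof -
      have "(\<lambda>w. (\<zeta>, w)) \<in> circle_measure \<rightarrow>\<^sub>M torus_measure n \<Otimes>\<^sub>M circle_measure"
        using \<zeta> by (intro measurable_Pair1') simp
      from measurable_compose[OF measurable_compose[OF this upd_measurable_torus] continuous_on_torus_measurable[OF f]]
      show ?thesis by simp
    qed
    have idc [measurable]: "(\<lambda>w. w) \<in> borel_measurable circle_measure"
      by (intro borel_measurable_continuous_circle continuous_intros)
    have jm: "(\<lambda>(w, x). complex_of_real (poisson_disc (of_real \<rho> * (c * w)) x) * f (\<zeta>(n := w)))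
        \<in> borel_measurable (circle_measure \<Otimes>\<^sub>M \<sigma>)"
    proof -
      have [measurable]: "(\<lambda>p. fst p) \<in> borel_measurable (circle_measure \<Otimes>\<^sub>M \<sigma>)"
        "(\<lambda>p. snd p) \<in> borel_measurable (circle_measure \<Otimes>\<^sub>M \<sigma>)"
        "(\<lambda>p. f (\<zeta>(n := fst p))) \<in> borel_measurable (circle_measure \<Otimes>\<^sub>M \<sigma>)"
        using measurable_compose[OF measurable_fst idc] measurable_compose[OF measurable_snd borel_measurable_circle_ident[OF sets_\<sigma>]]
          measurable_compose[OF measurable_fst fc_meas] by auto
      show ?thesis unfolding case_prod_unfold by measurable
    qed
    have "A \<zeta> = (LINT w|circle_measure. LINT x|\<sigma>.
        complex_of_real (poisson_disc (of_real \<rho> * (c * w)) x) * f (\<zeta>(n := w)))"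
      unfolding A_def H_def prod_upd_last c_def by simp
    also have "\<dots> = (LINT x|\<sigma>. LINT w|circle_measure.
        complex_of_real (poisson_disc (of_real \<rho> * (c * w)) x) * f (\<zeta>(n := w)))"
    proof (rule integral_swap_bounded[OF _ fin jm])
      show "finite_measure circle_measure" by (rule circle_measure.finite_measure_axioms)
      fix w x assume "w \<in> space circle_measure" "x \<in> space \<sigma>"
      then show "norm (complex_of_real (poisson_disc (of_real \<rho> * (c * w)) x) * f (\<zeta>(n := w))) \<le> ?K * B"
        unfolding norm_mult[of "complex_of_real _"]
        using c B pd[of "c * w" x] torus_upd[OF \<zeta>]
        by (intro mult_mono) (auto simp: space_circle_borel[OF sets_\<sigma>] norm_mult)
    qed
    finally have A_eq: "A \<zeta> = \<dots>" .
    let ?P = "\<lambda>x. LINT w|circle_measure. complex_of_real (poisson_disc (of_real \<rho> * (c * w)) x) * f (\<zeta>(n := w))"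
    have pt: "norm (?P x - f (\<zeta>(n := x * cnj c))) \<le> ?E" if "x \<in> circle" for x
    proof -
      let ?y = "x * cnj c"
      have y: "norm ?y = 1" using that c by (simp add: norm_mult)
      have z: "of_real \<rho> * ?y \<in> disc" using y \<rho> by (simp add: norm_mult)
      have "?P x = (LINT w|circle_measure. complex_of_real (poisson_disc (of_real \<rho> * ?y) w) * f (\<zeta>(n := w)))"
        using that by (intro Bochner_Integration.integral_cong refl) (simp add: poisson_disc_rotate[OF c])
      moreover have "norm ((LINT w|circle_measure. complex_of_real (poisson_disc (of_real \<rho> * ?y) w) * f (\<zeta>(n := w)))
          - f (\<zeta>(n := ?y))) \<le> ?E"
      proof (rule kernel_average_error[where D = "\<lambda>w. (norm (w - ?y))\<^sup>2" and B = B])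
        show "integrable circle_measure (poisson_disc (of_real \<rho> * ?y))"
          using integrable_poisson_disc_mult[OF z, of "\<lambda>_. 1"] by simp
        show "integrable circle_measure (\<lambda>w. poisson_disc (of_real \<rho> * ?y) w * (norm (w - ?y))\<^sup>2)"
          by (intro integrable_poisson_disc_mult[OF z] continuous_intros)
        show "(LINT w|circle_measure. poisson_disc (of_real \<rho> * ?y) w * (norm (w - ?y))\<^sup>2) = 2 - 2 * \<rho>"
          using y \<rho> by (rule integral_poisson_disc_dist_sq)
        fix w assume w: "w \<in> space circle_measure"
        show "0 \<le> poisson_disc (of_real \<rho> * ?y) w"
          using z by (intro poisson_disc_nonneg) simp
        show "norm (f (\<zeta>(n := w))) \<le> B" using w B torus_upd[OF \<zeta>] by simp
        \<comment> \<open>The two points differ only in coordinate \<open>n\<close>, so the sum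
          collapses to its last term.\<close>
        have "norm (f (\<zeta>(n := w)) - f (\<zeta>(n := ?y))) \<le>
            \<epsilon> + C * (\<Sum>j<Suc n. (norm ((\<zeta>(n := w)) j - (\<zeta>(n := ?y)) j))\<^sup>2)"
          using w y by (intro mod torus_upd[OF \<zeta>]) auto
        then show "norm (f (\<zeta>(n := w)) - f (\<zeta>(n := ?y))) \<le> \<epsilon> + C * (norm (w - ?y))\<^sup>2"
          by simp
      qed (use integral_poisson_disc[OF z] fc_meas in auto)
      ultimately show ?thesis by simp
    qed
    have gb: "norm (f (\<zeta>(n := x * cnj c))) \<le> B" if "x \<in> circle" for x
      using B anti[OF \<zeta> that] by (simp add: c_def)
    have gm: "(\<lambda>x. f (\<zeta>(n := x * cnj c))) \<in> borel_measurable \<sigma>"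
    proof -
      have "(\<lambda>x. (\<zeta>, x)) \<in> \<sigma> \<rightarrow>\<^sub>M torus_measure n \<Otimes>\<^sub>M \<sigma>"
        using \<zeta> by (intro measurable_Pair1') simp
      from measurable_compose[OF this antidiagonal_measurable] show ?thesis by (simp add: c_def)
    qed
    have "integrable \<sigma> (\<lambda>x. f (\<zeta>(n := x * cnj c)))"
      using gm gb by (intro \<sigma>.integrable_const_bound[of _ B] AE_I2) (auto simp: space_circle_borel[OF sets_\<sigma>])
    moreover have "integrable \<sigma> ?P"
    proof (intro \<sigma>.integrable_const_bound[of _ "B + ?E"] AE_I2)
      show "?P \<in> borel_measurable \<sigma>"
        using measurable_compose[OF measurable_pair_swap' jm]
        by (intro circle_measure.borel_measurable_lebesgue_integral) (simp add: case_prod_unfold)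
      fix x assume "x \<in> space \<sigma>"
      then show "norm (?P x) \<le> B + ?E"
        using pt[of x] gb[of x] norm_triangle_ineq[of "?P x - f (\<zeta>(n := x * cnj c))" "f (\<zeta>(n := x * cnj c))"]
        by (simp add: space_circle_borel[OF sets_\<sigma>])
    qed
    ultimately show ?thesis
      unfolding A_eq G_def c_def[symmetric] using pt E
      by (intro \<sigma>.norm_integral_diff_le) (auto simp: space_circle_borel[OF sets_\<sigma>])
  qed

  have "(LINT \<eta>|torus_measure (Suc n). H \<eta>) = (LINT \<zeta>|torus_measure n. A \<zeta>)"
    unfolding A_def using H_meas H_bound by (rule integral_torus_Suc)
  moreover have "iterated_circle_integral n G = (LINT \<zeta>|torus_measure n. G \<zeta>)"
    using B(1) by (intro iterated_circle_integral_eq[OF G_meas G_bound]) auto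
  moreover have "integrable (torus_measure n) A" "integrable (torus_measure n) G"
    by (rule integrable_torus_bounded[OF A_meas A_bound] integrable_torus_bounded[OF G_meas G_bound]; assumption)+
  ultimately have "norm ((LINT \<eta>|torus_measure (Suc n). H \<eta>) - iterated_circle_integral n G) \<le>
      measure (torus_measure n) (space (torus_measure n)) * (?S * ?E)"
    using torus_measure.norm_integral_diff_le[of n A G "?S * ?E"] close E by simp
  then show ?thesis
    unfolding H_def G_def by (simp add: torus_measure.prob_space del: space_torus_measure)
qed

end

text \<open>Both sides are compared with the double integral \<open>?M\<close> of the dilated
  kernel: \<open>?L\<close> directly, and \<open>?R\<close> after the Poisson integral of
  \<open>\<tau>\<close> has been replaced by that of \<open>\<sigma>\<close>.\<close>

theorem clark_integral_prod:
  assumes \<sigma>: "clark_measure_disc \<phi> \<alpha> \<sigma>"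
    and \<tau>: "clark_measure_polydisc (Suc n) (\<lambda>z. \<phi> (\<Prod>j<Suc n. z j)) \<alpha> \<tau>"
    and f: "continuous_on (torus (Suc n)) f"
  shows "(LINT \<xi>|\<tau>. f \<xi>) =
    iterated_circle_integral n (\<lambda>\<zeta>. LINT x|\<sigma>. f (\<zeta>(n := x * cnj (\<Prod>j<n. \<zeta> j))))"
    (is "?L = ?R")
proof -
  let ?d = "Suc n"
  let ?T = "measure \<tau> (space \<tau>)" and ?S = "measure \<sigma> (space \<sigma>)"
  have fin: "finite_measure \<sigma>" "finite_measure \<tau>"
    using finite_measure_clark_disc[OF \<sigma>] finite_measure_clark_polydisc[OF \<tau>] .
  have sets: "sets \<sigma> = sets (restrict_space borel circle)" "sets \<tau> = sets (restrict_space borel (torus ?d))"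
    using \<sigma> \<tau> by (auto simp: clark_measure_disc_def clark_measure_polydisc_def)
  \<comment> \<open>The two Clark identities have the same right-hand side, because the function on
    the polydisc at \<open>z\<close> is \<open>\<phi>\<close> at the product of the coordinates.
    Nonnegativity of the kernels transfers the equality from \<open>[0, \<infinity>]\<close> to real
    integrals.\<close>
  have U: "(LINT \<zeta>|\<tau>. poisson_polydisc ?d z \<zeta>) = (LINT x|\<sigma>. poisson_disc (\<Prod>j<?d. z j) x)"
    if z: "z \<in> polydisc ?d" for z
  proof -
    have pz: "(\<Prod>j<?d. z j) \<in> disc" using z by (rule prod_in_disc) simp
    have zj: "norm (z j) \<le> 1" if "j < ?d" for j
      using z that by (force simp: polydisc_def PiE_def Pi_def less_imp_le)
    have nn: "0 \<le> poisson_polydisc ?d z \<zeta>" for \<zeta>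
      unfolding poisson_polydisc_def using zj by (intro prod_nonneg poisson_disc_nonneg) auto
    have m: "(\<lambda>\<zeta>. \<zeta> j) \<in> borel_measurable \<tau>" for j
      by (intro borel_measurable_continuous_on_torus[OF sets(2)] continuous_on_coordinate)
    have pm: "poisson_polydisc ?d z \<in> borel_measurable \<tau>"
      unfolding poisson_polydisc_def
      by (intro borel_measurable_prod poisson_disc_measurable borel_measurable_const m)
    have "(LINT \<zeta>|\<tau>. poisson_polydisc ?d z \<zeta>) = enn2real (\<integral>\<^sup>+\<zeta>. ennreal (poisson_polydisc ?d z \<zeta>) \<partial>\<tau>)"
      using nn pm by (intro integral_eq_nn_integral) auto
    also have "\<dots> = enn2real (\<integral>\<^sup>+x. ennreal (poisson_disc (\<Prod>j<?d. z j) x) \<partial>\<sigma>)"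
      using \<sigma> \<tau> z pz by (simp add: clark_measure_disc_def clark_measure_polydisc_def del: prod.lessThan_Suc)
    also have "\<dots> = (LINT x|\<sigma>. poisson_disc (\<Prod>j<?d. z j) x)"
      using pz poisson_disc_nonneg[of "\<Prod>j<?d. z j"] borel_measurable_circle_ident[OF sets(1)]
      by (intro integral_eq_nn_integral[symmetric] poisson_disc_measurable borel_measurable_const AE_I2)
         (simp_all del: prod.lessThan_Suc)
    finally show ?thesis .
  qed
  have main: "norm (?L - ?R) \<le> (?T + ?S) * \<epsilon>" if \<epsilon>: "0 < \<epsilon>" for \<epsilon>
  proof -
    obtain C where C: "0 \<le> C" and mod: "\<And>\<zeta> \<eta>. \<zeta> \<in> torus ?d \<Longrightarrow> \<eta> \<in> torus ?d \<Longrightarrow>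
        norm (f \<eta> - f \<zeta>) \<le> \<epsilon> + C * (\<Sum>j<?d. (norm (\<eta> j - \<zeta> j))\<^sup>2)"
      using torus_continuity_modulus[OF f \<epsilon>] by blast
    have le: "norm (?L - ?R) \<le> ?T * (\<epsilon> + C * (of_nat ?d * (2 - 2 * r))) + ?S * (\<epsilon> + C * (2 - 2 * r ^ ?d))"
      if r: "0 \<le> r" "r < 1" for r
    proof -
      let ?M = "LINT \<zeta>|\<tau>. LINT \<eta>|torus_measure ?d. complex_of_real (\<Prod>j<?d. poisson_disc (of_real r * \<zeta> j) (\<eta> j)) * f \<eta>"
      \<comment> \<open>Dilating each of the \<open>?d\<close> coordinates by \<open>r\<close>
        dilates their product by \<open>r ^ ?d\<close>, which is the radius on the circle
        side.\<close>
      have \<rho>: "0 \<le> r ^ ?d" "r ^ ?d < 1"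
        using r by (auto intro: power_less_one_iff[THEN iffD2] simp del: power_Suc)
      have "?M = (LINT \<eta>|torus_measure ?d.
          of_real (LINT x|\<sigma>. poisson_disc (\<Prod>j<?d. (\<lambda>j\<in>{..<?d}. of_real r * \<eta> j) j) x) * f \<eta>)"
        by (rule poisson_extension_swap[OF fin(2) sets(2) f r, of "\<lambda>z. LINT x|\<sigma>. poisson_disc (\<Prod>j<?d. z j) x"]) (rule U)
      also have "\<dots> = (LINT \<eta>|torus_measure ?d.
          of_real (LINT x|\<sigma>. poisson_disc (of_real (r ^ ?d) * (\<Prod>j<?d. \<eta> j)) x) * f \<eta>)"
      proof -
        have "(\<Prod>j<?d. (\<lambda>j\<in>{..<?d}. of_real r * \<eta> j) j) = complex_of_real (r ^ ?d) * (\<Prod>j<?d. \<eta> j)" for \<eta>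
        proof -
          have "(\<Prod>j<?d. (\<lambda>j\<in>{..<?d}. of_real r * \<eta> j) j) = (\<Prod>j<?d. complex_of_real r * \<eta> j)"
            by (rule prod.cong) auto
          then show ?thesis by (simp only: prod.distrib prod_constant card_lessThan of_real_power)
        qed
        then show ?thesis by (simp only:)
      qed
      finally have M: "?M = \<dots>" .
      have "norm (?M - ?L) \<le> ?T * (\<epsilon> + C * (of_nat ?d * (2 - 2 * r)))"
        by (rule poisson_extension_error[OF fin(2) sets(2) f r C less_imp_le[OF \<epsilon>] mod])
      moreover have "norm (?M - ?R) \<le> ?S * (\<epsilon> + C * (2 - 2 * r ^ ?d))"
        unfolding M by (rule poisson_average_error[OF fin(1) sets(1) f \<rho> C less_imp_le[OF \<epsilon>] mod])
      moreover have "norm (?L - ?R) \<le> norm (?M - ?L) + norm (?M - ?R)"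
        using dist_triangle3[of ?L ?R ?M] by (simp only: dist_norm)
      ultimately show ?thesis by linarith
    qed
    let ?b = "\<lambda>r. ?T * (\<epsilon> + C * (of_nat ?d * (2 - 2 * r))) + ?S * (\<epsilon> + C * (2 - 2 * r ^ ?d))"
    \<comment> \<open>\<open>C\<close> depends on \<open>\<epsilon>\<close> but not on
      \<open>r\<close>, so \<open>r\<close> may tend to 1 first, leaving only the terms with
      \<open>\<epsilon>\<close>.\<close>
    have "(?b \<longlongrightarrow> ?b 1) (at_left 1)"
      by (intro tendsto_intros)
    moreover have "\<forall>\<^sub>F r in at_left (1 :: real). norm (?L - ?R) \<le> ?b r"
      by (rule eventually_mono[OF eventually_at_left_real[of 0 1]]) (use le in auto)
    ultimately have "norm (?L - ?R) \<le> ?b 1"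
      by (intro tendsto_lowerbound[of ?b]) auto
    then show ?thesis by (simp add: algebra_simps)
  qed
  have "norm (?L - ?R) \<le> 0"
  proof (rule field_le_epsilon)
    fix e :: real assume e: "0 < e"
    \<comment> \<open>Adding 1 keeps the denominator positive even if both masses are 0.\<close>
    have s: "0 < ?T + ?S + 1" using measure_nonneg[of \<tau> "space \<tau>"] measure_nonneg[of \<sigma> "space \<sigma>"] by linarith
    have "norm (?L - ?R) \<le> (?T + ?S) * (e / (?T + ?S + 1))"
      using e s by (intro main) simp
    also have "\<dots> \<le> (?T + ?S + 1) * (e / (?T + ?S + 1))"
      using e s by (intro mult_right_mono) auto
    finally show "norm (?L - ?R) \<le> 0 + e" using s by simp
  qed
  then show ?thesis by simp
qed

theorem theorem4p6:
  fixes d :: nat and \<phi> :: "complex \<Rightarrow> complex" and \<alpha> :: complex and \<sigma> :: "complex measure"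
  assumes "d \<ge> 2"
    and "norm \<alpha> = 1"
    and "inner_disc \<phi>"
    and "clark_measure_disc \<phi> \<alpha> \<sigma>"
  shows "inner_polydisc d (\<lambda>z. \<phi> (\<Prod>j<d. z j)) \<and>
    (\<forall>\<tau>. clark_measure_polydisc d (\<lambda>z. \<phi> (\<Prod>j<d. z j)) \<alpha> \<tau> \<longrightarrow>
      (\<forall>f :: (nat \<Rightarrow> complex) \<Rightarrow> complex. continuous_on (torus d) f \<longrightarrow>
        (LINT \<xi>|\<tau>. f \<xi>) =
        iterated_circle_integral (d - 1)
          (\<lambda>\<zeta>. LINT x|\<sigma>. f (\<zeta>(d - 1 := x * cnj (\<Prod>j<d - 1. \<zeta> j))))))"
proof -
  \<comment> \<open>Coordinates are numbered from 0, so the last one has index \<open>d - 1\<close>,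
    which takes the place of \<open>n\<close> in \<open>clark_integral_prod\<close>.\<close>
  have d: "d = Suc (d - 1)" using assms(1) by simp
  have "inner_polydisc d (\<lambda>z. \<phi> (\<Prod>j<d. z j))"
    using assms by (intro inner_polydisc_prod) auto
  then show ?thesis
    using clark_integral_prod[OF assms(4), of "d - 1", folded d] by blast
qed

end
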